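(* Let $F$ be a homogeneous polynomial of degree $d$ on $W\cong\mathbb{C}^{N+1}$, where $d\ge 3$. Let $X\subset P(W)$ be a closed subscheme, and let $Q$ be the quadratic form on the trivial bundle $V=X\times W$, with values in $\mathcal{O}_X(d-2)$, defined by the second derivatives of $F$. Suppose that the maximal rank of $Q$ (at points of $X$) is $r$. If $\dim X>N+1-r$, then the locus $X_{r-1}$ is nonempty.
   Context: Everything is over $\mathbb{C}$; $P(W)$ is the projective space of lines in $W$. For $\tilde p\in W$ let $\tilde Q_{\tilde p}$ be the symmetric bilinear form on $W$ given by $\tilde Q_{\tilde p}(v,w)=(D_vD_wF)(\tilde p)$, where $D$ denotes directional derivative; in linear coordinates $X_0,\dots,X_N$ on $W$ its matrix is $\left(\frac{\partial^2F}{\partial X_i\partial X_j}(\tilde p)\right)$. The $\mathcal{O}_X(d-2)$-valued quadratic form $Q$ on $V=X\times W$ is defined as follows: for $p\in X$ and $w_1,w_2\in W$, $Q_p(w_1,w_2)$ is the homogeneous polynomial of degree $d-2$ on the line $\mathbb{C}\cdot\tilde p$ corresponding to $p$ (an element of the fiber of $\mathcal{O}_X(d-2)$ at $p$) whose value at $\tilde p$ is $\tilde Q_{\tilde p}(w_1,w_2)$. Thus the rank of $Q_p$ equals the rank of the matrix $\left(\frac{\partial^2F}{\partial X_i\partial X_j}(\tilde p)\right)_{i,j=0}^{N}$ at any nonzero $\tilde p$ lying over $p$. For an integer $s$, $X_s=\{p\in X:\operatorname{rank}Q_p\le s\}$. *)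

theory Defs
  imports "HOL-Analysis.Analysis" "HOL-Library.Poly_Mapping"
begin

section \<open>Polynomials on complex affine space\<close>

text \<open>
  A monomial is a finitely supported exponent vector \<open>'n \<Rightarrow>\<^sub>0 nat\<close>; the library's convolution
  product makes \<open>'n cpoly\<close> the polynomial ring over the complex numbers in the variables \<open>X\<^sub>i\<close>,
  \<open>i :: 'n\<close>. The vector space \<open>W\<close> is \<open>complex ^ 'n\<close>, so \<open>dim W = CARD('n)\<close>.
\<close>

type_synonym 'n cpoly = "('n \<Rightarrow>\<^sub>0 nat) \<Rightarrow>\<^sub>0 complex"

definition mon_degree :: "('n::finite \<Rightarrow>\<^sub>0 nat) \<Rightarrow> nat" where
  "mon_degree m = (\<Sum>i\<in>UNIV. Poly_Mapping.lookup m i)"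

definition eval_poly :: "'n::finite cpoly \<Rightarrow> complex ^ 'n \<Rightarrow> complex" where
  "eval_poly F v =
     (\<Sum>m\<in>Poly_Mapping.keys F. Poly_Mapping.lookup F m * (\<Prod>i\<in>UNIV. (v $ i) ^ Poly_Mapping.lookup m i))"

text \<open>The zero polynomial is homogeneous of every degree.\<close>

definition homogeneous :: "nat \<Rightarrow> 'n::finite cpoly \<Rightarrow> bool" where
  "homogeneous d F \<longleftrightarrow> (\<forall>m\<in>Poly_Mapping.keys F. mon_degree m = d)"

definition homogeneous_ideal :: "'n::finite cpoly set \<Rightarrow> bool" where
  "homogeneous_ideal I \<longleftrightarrow>
     0 \<in> I \<and> (\<forall>f\<in>I. \<forall>g\<in>I. f + g \<in> I) \<and> (\<forall>f. \<forall>g\<in>I. f * g \<in> I) \<and>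
     (\<forall>f\<in>I. \<forall>k. \<exists>g\<in>I. \<forall>m.
        Poly_Mapping.lookup g m = (if mon_degree m = k then Poly_Mapping.lookup f m else 0))"


section \<open>Projective space and its closed subschemes\<close>

definition proj_space :: "(complex ^ 'n::finite) set set" where
  "proj_space = {p. \<exists>v. v \<noteq> 0 \<and> p = vec.span {v}}"

text \<open>Generated by the distinguished open sets, which form a basis.\<close>

definition zariski :: "(complex ^ 'n::finite) set topology" where
  "zariski = topology_generated_by
     {{p \<in> proj_space. \<exists>v\<in>p. eval_poly G v \<noteq> 0} | G k. homogeneous k G}"

text \<open>
  A closed subscheme of projective space is given by a homogeneous ideal \<open>I\<close>; \<open>proj_points I\<close> is
  its set of closed points and \<open>proj_top I\<close> the Zariski topology on it.
\<close>

definition proj_points :: "'n::finite cpoly set \<Rightarrow> (complex ^ 'n) set set" where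
  "proj_points I = {p \<in> proj_space. \<forall>f\<in>I. \<forall>v\<in>p. eval_poly f v = 0}"

definition proj_top :: "'n::finite cpoly set \<Rightarrow> (complex ^ 'n) set topology" where
  "proj_top I = subtopology zariski (proj_points I)"

definition irreducible_closed :: "'a topology \<Rightarrow> 'a set \<Rightarrow> bool" where
  "irreducible_closed T Z \<longleftrightarrow>
     closedin T Z \<and> Z \<noteq> {} \<and>
     (\<forall>A B. closedin T A \<and> closedin T B \<and> Z = A \<union> B \<longrightarrow> Z = A \<or> Z = B)"

text \<open>
  Krull dimension of a topological space: the supremum of the lengths of strict chains of
  irreducible closed subsets. It is \<open>-\<infinity>\<close> for the empty space. For a scheme of finite type over the
  complex numbers, the space of closed points has the same dimension as the whole scheme.
\<close>

definition krull_dim :: "'a topology \<Rightarrow> ereal" where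
  "krull_dim T = (SUP n \<in> {n. \<exists>Z. (\<forall>i\<le>n. irreducible_closed T (Z i)) \<and> (\<forall>i<n. Z i \<subset> Z (Suc i))}.
     ereal (real n))"


section \<open>The quadratic form of second derivatives\<close>

definition dir_deriv :: "complex ^ 'n::finite \<Rightarrow> (complex ^ 'n \<Rightarrow> complex) \<Rightarrow> complex ^ 'n \<Rightarrow> complex" where
  "dir_deriv w f x = deriv (\<lambda>t. f (x + t *s w)) 0"

text \<open>
  The value of \<open>Q\<close> at the point \<open>p\<close> and the pair \<open>v, w\<close> lies in the fibre of \<open>\<O>(d - 2)\<close> at \<open>p\<close>,
  that is, it is a function on the line \<open>p\<close>, homogeneous of degree \<open>d - 2\<close>
  (see \<open>hessian_form_homogeneous\<close>).
\<close>

definition hessian_form ::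
    "'n::finite cpoly \<Rightarrow> (complex ^ 'n) set \<Rightarrow> complex ^ 'n \<Rightarrow> complex ^ 'n \<Rightarrow> complex ^ 'n \<Rightarrow> complex" where
  "hessian_form F p v w = restrict (dir_deriv v (dir_deriv w (eval_poly F))) p"

text \<open>Matrix of the form, after trivialising the fibre by evaluation at \<open>x \<in> p\<close>.\<close>

definition hessian_matrix :: "'n::finite cpoly \<Rightarrow> (complex ^ 'n) set \<Rightarrow> complex ^ 'n \<Rightarrow> complex ^ 'n ^ 'n" where
  "hessian_matrix F p x = (\<chi> i j. hessian_form F p (axis i 1) (axis j 1) x)"

text \<open>
  The choice of the nonzero vector on the line is immaterial for homogeneous \<open>F\<close>
  (see \<open>form_rank_eq\<close>).
\<close>

definition form_rank :: "'n::finite cpoly \<Rightarrow> (complex ^ 'n) set \<Rightarrow> nat" where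
  "form_rank F p = rank (hessian_matrix F p (SOME x. x \<in> p \<and> x \<noteq> 0))"

text \<open>The index \<open>s\<close> is an integer, so that \<open>s = - 1\<close> gives the empty locus.\<close>

definition rank_locus :: "'n::finite cpoly \<Rightarrow> 'n cpoly set \<Rightarrow> int \<Rightarrow> (complex ^ 'n) set set" where
  "rank_locus F I s = {p \<in> proj_points I. int (form_rank F p) \<le> s}"


subsection \<open>Homogeneity of the form and independence of the representative\<close>

lemma eval_poly_scale:
  assumes "homogeneous d F"
  shows "eval_poly F (c *s x) = c ^ d * eval_poly F x"
proof -
  have "Poly_Mapping.lookup F m * (\<Prod>i\<in>UNIV. ((c *s x) $ i) ^ Poly_Mapping.lookup m i)
      = c ^ d * (Poly_Mapping.lookup F m * (\<Prod>i\<in>UNIV. (x $ i) ^ Poly_Mapping.lookup m i))"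
    if "m \<in> Poly_Mapping.keys F" for m
  proof -
    have "d = (\<Sum>i\<in>UNIV. Poly_Mapping.lookup m i)"
      using that assms by (auto simp: homogeneous_def mon_degree_def)
    then show ?thesis
      by (simp add: power_mult_distrib prod.distrib power_sum)
  qed
  then show ?thesis
    unfolding eval_poly_def sum_distrib_left by (rule sum.cong[OF refl])
qed

lemma eval_poly_line_deriv:
  "((\<lambda>t. eval_poly F (x + t *s w)) has_field_derivative
     (\<Sum>m\<in>Poly_Mapping.keys F. Poly_Mapping.lookup F m *
       (\<Sum>i\<in>UNIV. (of_nat (Poly_Mapping.lookup m i) * (x $ i) ^ (Poly_Mapping.lookup m i - 1) * w $ i)
          * (\<Prod>j\<in>UNIV - {i}. (x $ j) ^ Poly_Mapping.lookup m j)))) (at 0)"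
  unfolding eval_poly_def
  apply (rule DERIV_sum)
  apply (rule DERIV_cmult)
  apply (rule DERIV_cong)
   apply (rule has_field_derivative_prod)
   apply (auto intro!: derivative_eq_intros sum.cong)
  done

lemma dir_deriv_eval_poly:
  "dir_deriv w (eval_poly F) = (\<lambda>x. \<Sum>m\<in>Poly_Mapping.keys F. Poly_Mapping.lookup F m *
       (\<Sum>i\<in>UNIV. (of_nat (Poly_Mapping.lookup m i) * (x $ i) ^ (Poly_Mapping.lookup m i - 1) * w $ i)
          * (\<Prod>j\<in>UNIV - {i}. (x $ j) ^ Poly_Mapping.lookup m j)))"
  unfolding dir_deriv_def by (rule ext, rule DERIV_imp_deriv, rule eval_poly_line_deriv)

lemma dir_deriv_line_differentiable:
  "(\<lambda>t. dir_deriv w (eval_poly F) (x + t *s u)) field_differentiable (at 0)"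
proof -
  have "(\<lambda>t. dir_deriv w (eval_poly F) (x + t *s u)) holomorphic_on UNIV"
    unfolding dir_deriv_eval_poly by (auto intro!: holomorphic_intros)
  then show ?thesis
    by (auto simp: holomorphic_on_def)
qed

lemma dir_deriv_scale:
  fixes f :: "complex ^ 'n::finite \<Rightarrow> complex"
  assumes hom: "\<And>c x. f (c *s x) = c ^ Suc k * f x"
    and diff: "\<And>x. (\<lambda>t. f (x + t *s w)) field_differentiable (at 0)"
    and k: "k \<ge> 1"
  shows "dir_deriv w f (c *s x) = c ^ k * dir_deriv w f x"
proof (cases "c = 0")
  case True
  have "((\<lambda>t. t ^ Suc k * f w) has_field_derivative 0) (at 0)"
    using k by (auto intro!: derivative_eq_intros)
  then have "dir_deriv w f 0 = 0"
    by (simp only: dir_deriv_def hom add_0_left) (rule DERIV_imp_deriv)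
  with True k show ?thesis by simp
next
  case False
  define g where "g = (\<lambda>t. f (x + t *s w))"
  have g: "(g has_field_derivative dir_deriv w f x) (at (0 / c))"
    using diff[of x] by (simp add: g_def dir_deriv_def field_differentiable_derivI)
  have "f (c *s x + t *s w) = c ^ Suc k * g (t / c)" for t
    using False by (simp add: g_def flip: hom del: power_Suc)
  then have eq: "(\<lambda>t. f (c *s x + t *s w)) = (\<lambda>t. c ^ Suc k * g (t / c))" by simp
  have "((\<lambda>t. g (t / c)) has_field_derivative dir_deriv w f x * (1 / c)) (at 0)"
    by (rule DERIV_chain2[where g = "\<lambda>t. t / c", OF g]) (use False in \<open>auto intro!: derivative_eq_intros\<close>)
  then have "((\<lambda>t. c ^ Suc k * g (t / c)) has_field_derivative
      c ^ Suc k * (dir_deriv w f x * (1 / c))) (at 0)"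
    by (rule DERIV_cmult)
  then show ?thesis
    using False unfolding dir_deriv_def[of w f "c *s x"] eq by (simp add: DERIV_imp_deriv)
qed

lemma second_deriv_scale:
  assumes F: "homogeneous d F" and d: "d \<ge> 3"
  shows "dir_deriv v (dir_deriv w (eval_poly F)) (c *s x)
       = c ^ (d - 2) * dir_deriv v (dir_deriv w (eval_poly F)) x"
proof -
  have "dir_deriv w (eval_poly F) (c *s x) = c ^ Suc (d - 2) * dir_deriv w (eval_poly F) x" for c x
    by (rule dir_deriv_scale)
      (use d F eval_poly_line_deriv in
        \<open>auto simp: eval_poly_scale[OF F] field_differentiable_def Suc_diff_Suc numeral_2_eq_2 simp flip: power_Suc\<close>)
  then show ?thesis
    by (rule dir_deriv_scale) (use d dir_deriv_line_differentiable in auto)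
qed

lemma hessian_form_homogeneous:
  assumes "homogeneous d F" "d \<ge> 3" "p \<in> proj_space" "x \<in> p"
  shows "hessian_form F p v w (c *s x) = c ^ (d - 2) * hessian_form F p v w x"
proof -
  have "c *s x \<in> p"
    using assms(3,4) by (auto simp: proj_space_def vec.span_scale)
  with assms show ?thesis
    by (simp add: hessian_form_def second_deriv_scale)
qed

lemma form_rank_eq:
  assumes F: "homogeneous d F" and d: "d \<ge> 3" and p: "p \<in> proj_space" and x: "x \<in> p" "x \<noteq> 0"
  shows "form_rank F p = rank (hessian_matrix F p x)"
proof -
  define y where "y = (SOME x. x \<in> p \<and> x \<noteq> 0)"
  have y: "y \<in> p" "y \<noteq> 0"
    using someI[of "\<lambda>x. x \<in> p \<and> x \<noteq> 0" x] x by (auto simp: y_def)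
  obtain v where v: "v \<noteq> 0" "p = vec.span {v}" using p by (auto simp: proj_space_def)
  obtain a b where ab: "x = a *s v" "y = b *s v"
    using x y v by (auto simp: vec.span_singleton)
  define c where "c = b / a"
  have "a \<noteq> 0" "b \<noteq> 0" using x y ab by auto
  then have c: "c \<noteq> 0" and yc: "y = c *s x" using ab by (auto simp: c_def)
  have rows: "rows (hessian_matrix F p y) = (\<lambda>u. c ^ (d - 2) *s u) ` rows (hessian_matrix F p x)"
  proof -
    have "row i (hessian_matrix F p y) = c ^ (d - 2) *s row i (hessian_matrix F p x)" for i
      by (simp add: row_def yc hessian_matrix_def hessian_form_homogeneous[OF F d p x(1)] vec_eq_iff)
    then show ?thesis by (auto simp: rows_def)
  qed
  have "vec.dim ((\<lambda>u. c ^ (d - 2) *s u) ` S) = vec.dim S" for S :: "(complex ^ 'a) set"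
  proof -
    have lin: "Vector_Spaces.linear (*s) (*s) (\<lambda>u :: complex ^ 'a. c ^ (d - 2) *s u)"
      by (simp add: vec.linear_scale_self)
    show ?thesis
      by (rule vec.dim_image_eq[OF lin]) (use c in \<open>auto simp: inj_on_def\<close>)
  qed
  then show ?thesis
    by (simp add: form_rank_def row_rank_def_gen rows flip: y_def)
qed

end

theory Submission
  imports Defs "HOL-Computational_Algebra.Fundamental_Theorem_Algebra"
begin

text \<open>
  Write \<open>n = N + 1\<close>, let \<open>A x\<close> be the Hessian matrix at \<open>x\<close>, a symmetric matrix of forms of degree
  \<open>e = d - 2 \<ge> 1\<close>, and suppose that \<open>A\<close> has rank exactly \<open>r\<close> at all points of the subscheme \<open>X\<close> defined by the ideal \<open>I\<close>. The claim is then that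
  a chain of irreducible closed subsets of \<open>X\<close> has length \<open>D \<le> n - r\<close>. Let \<open>Z\<close> be the cone over the
  top member of the chain.

  The geometric idea is this. For \<open>\<lambda> \<in> W\<^sup>*\<close> the points \<open>x\<close> of \<open>Z\<close> with \<open>\<lambda>\<close> in the image of \<open>A x\<close> form a
  closed set, by constancy of the rank. The pairs \<open>(x, \<lambda>)\<close> form a projective variety of dimension
  \<open>D + r - 1\<close>, so if \<open>D + r > n\<close> these closed sets have positive dimension unless empty. On each of them the
  inverse quadratic form, \<open>A x w \<mapsto> w\<^sup>T A x w\<close> evaluated at \<open>\<lambda>\<close>, is a section of the negative line bundle
  of degree \<open>- e\<close>, and therefore zero. So \<open>w\<^sup>T A x w\<close> vanishes identically, which is absurd for a
  nonzero symmetric matrix.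

  The formal proof replaces dimension theory by counting. With \<open>\<lambda> = A x w\<close> and
  \<open>q = w\<^sup>T A x w\<close>, Cramer's rule for a suitable invertible perturbation of \<open>A x\<close> gives relations
  \<open>q h(x) = \<Sum> \<lambda>\<^sub>k \<lambda>\<^sub>m g\<^sub>k\<^sub>m(x)\<close> in which the forms \<open>h\<close> have no common zero on \<open>Z\<close>
  (\<open>pencil_relation\<close>, \<open>quad_ideal_no_zero\<close>). By the projective Nullstellensatz
  (\<open>projective_nullstellensatz\<close>) every form \<open>h\<close> of large degree satisfies such a relation, and
  iterating shows that \<open>q\<^sup>a\<close> times any form of degree \<open>t + a e\<close> in \<open>x\<close> is a combination of monomials in
  \<open>\<lambda>\<close> of degree \<open>2 a\<close> with coefficients forms of the fixed degree \<open>t\<close> (\<open>quad_power_in_span\<close>). After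
  multiplication by the monomials in \<open>r\<close> generic coordinates of \<open>\<lambda>\<close> with exponents below \<open>a\<close>, the
  products stay in a space of dimension \<open>O(a\<^sup>n)\<close>. They are nevertheless independent, because \<open>A x\<close> maps
  onto these \<open>r\<close> coordinates (\<open>card_bound\<close>). A chain of length \<open>D\<close> provides at least \<open>c a\<^sup>D\<close>
  independent forms on \<open>Z\<close> (\<open>independent_forms_growth\<close>), so that \<open>D + r \<le> n\<close>
  (\<open>constant_rank_bound\<close>).
\<close>

section \<open>Homogeneous polynomial functions\<close>

text \<open>
  Forms are defined by recursion on the degree, so that statements about them can be proved by an
  induction in which only multiplication by coordinates occurs.
\<close>

primrec forms :: "nat \<Rightarrow> (complex ^ 'n::finite \<Rightarrow> complex) set" where
  "forms 0 = {f. \<exists>c. f = (\<lambda>x. c)}"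
| "forms (Suc t) = {f. \<exists>g. (\<forall>i. g i \<in> forms t) \<and> f = (\<lambda>x. \<Sum>i\<in>UNIV. x $ i * g i x)}"

declare forms.simps [simp del]

lemma forms_0I [intro, simp]: "(\<lambda>x. c) \<in> forms 0"
  by (auto simp: forms.simps)

lemma forms_0E:
  assumes "f \<in> forms 0" obtains c where "f = (\<lambda>x. c)"
  using assms by (auto simp: forms.simps)

lemma forms_SucI:
  "(\<And>i. g i \<in> forms t) \<Longrightarrow> (\<lambda>x. \<Sum>i\<in>UNIV. x $ i * g i x) \<in> forms (Suc t)"
  by (auto simp: forms.simps)

lemma forms_SucE:
  assumes "f \<in> forms (Suc t)"
  obtains g where "\<And>i. g i \<in> forms t" "f = (\<lambda>x. \<Sum>i\<in>UNIV. x $ i * g i x)"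
  using assms by (auto simp: forms.simps)

lemma forms_zero [intro, simp]: "(\<lambda>x. 0) \<in> forms t"
proof (induction t)
  case (Suc t)
  then show ?case using forms_SucI[of "\<lambda>i x. 0" t] by simp
qed auto

lemma forms_add:
  assumes "f \<in> forms t" "g \<in> forms t"
  shows "(\<lambda>x. f x + g x) \<in> forms t"
  using assms
proof (induction t arbitrary: f g)
  case (Suc t)
  then obtain f' g' where "\<And>i. f' i \<in> forms t" "f = (\<lambda>x. \<Sum>i\<in>UNIV. x $ i * f' i x)"
     "\<And>i. g' i \<in> forms t" "g = (\<lambda>x. \<Sum>i\<in>UNIV. x $ i * g' i x)"
    by (auto elim!: forms_SucE)
  with Suc.IH forms_SucI[of "\<lambda>i x. f' i x + g' i x" t] show ?case
    by (simp add: distrib_left sum.distrib)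
qed (auto elim!: forms_0E)

lemma forms_cmult:
  assumes "f \<in> forms t" shows "(\<lambda>x. c * f x) \<in> forms t"
  using assms
proof (induction t arbitrary: f)
  case (Suc t)
  then obtain f' where "\<And>i. f' i \<in> forms t" "f = (\<lambda>x. \<Sum>i\<in>UNIV. x $ i * f' i x)"
    by (auto elim: forms_SucE)
  with Suc.IH forms_SucI[of "\<lambda>i x. c * f' i x" t] show ?case
    by (simp add: sum_distrib_left mult.left_commute)
qed (auto elim!: forms_0E)

lemma forms_sum:
  assumes "\<And>i. i \<in> I \<Longrightarrow> f i \<in> forms t"
  shows "(\<lambda>x. \<Sum>i\<in>I. f i x) \<in> forms t"
  using assms by (induction I rule: infinite_finite_induct) (auto intro: forms_add)

lemma forms_coord_mult:
  fixes i :: "'n::finite"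
  assumes "f \<in> forms t" shows "(\<lambda>x. x $ i * f x) \<in> forms (Suc t)"
proof -
  have *: "x $ j * (if j = i then f x else 0) = (if j = i then x $ i * f x else 0)" for j and x :: "complex^'n"
    by auto
  have "(\<lambda>x. x $ i * f x) = (\<lambda>x. \<Sum>j\<in>UNIV. x $ j * (if j = i then f x else 0))"
    unfolding * by simp
  moreover have "(\<lambda>x. if j = i then f x else 0) \<in> forms t" for j
    using assms by (cases "j = i") auto
  ultimately show ?thesis
    using forms_SucI[of "\<lambda>j x. if j = i then f x else 0" t] by simp
qed

lemma forms_coord: "(\<lambda>x. x $ i) \<in> forms 1"
  using forms_coord_mult[of "\<lambda>x. 1" 0 i] by simp

lemma forms_mult:
  assumes "f \<in> forms t" "g \<in> forms u"
  shows "(\<lambda>x. f x * g x) \<in> forms (t + u)"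
  using assms
proof (induction t arbitrary: f)
  case 0
  then show ?case by (auto intro: forms_cmult elim!: forms_0E)
next
  case (Suc t)
  then obtain f' where "\<And>i. f' i \<in> forms t" "f = (\<lambda>x. \<Sum>i\<in>UNIV. x $ i * f' i x)"
    by (auto elim: forms_SucE)
  with Suc forms_SucI[of "\<lambda>i x. f' i x * g x" "t + u"] show ?case
    by (simp add: sum_distrib_right mult.assoc)
qed

lemma forms_power:
  assumes "f \<in> forms t" shows "(\<lambda>x. f x ^ k) \<in> forms (k * t)"
  by (induction k) (use assms in \<open>auto intro: forms_mult\<close>)

lemma forms_prod:
  assumes "\<And>i. i \<in> I \<Longrightarrow> f i \<in> forms (t i)"
  shows "(\<lambda>x. \<Prod>i\<in>I. f i x) \<in> forms (\<Sum>i\<in>I. t i)"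
  using assms by (induction I rule: infinite_finite_induct) (auto intro: forms_mult)

lemma forms_scale:
  assumes "f \<in> forms t" shows "f (c *s x) = c ^ t * f x"
  using assms
proof (induction t arbitrary: f)
  case (Suc t)
  then obtain f' where "\<And>i. f' i \<in> forms t" "f = (\<lambda>x. \<Sum>i\<in>UNIV. x $ i * f' i x)"
    by (auto elim: forms_SucE)
  with Suc.IH show ?case by (simp add: sum_distrib_left mult.left_commute mult.assoc)
qed (auto elim!: forms_0E)

text \<open>
  Expanding the recursion completely leaves words in the coordinates. Distinct words may give the same
  monomial; only the finiteness of this spanning set matters.
\<close>

lemma forms_word_expansion:
  fixes f :: "complex ^ 'n::finite \<Rightarrow> complex"
  assumes "f \<in> forms t"
  shows "\<exists>c. f = (\<lambda>x. \<Sum>ws\<in>{ws. length ws = t}. c ws * (\<Prod>i\<leftarrow>ws. x $ i))"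
  using assms
proof (induction t arbitrary: f)
  case (Suc t)
  from Suc.prems obtain g where g: "\<And>i. g i \<in> forms t" "f = (\<lambda>x. \<Sum>i\<in>UNIV. x $ i * g i x)"
    by (rule forms_SucE) blast
  from Suc.IH[OF g(1)] obtain c where
    c: "\<And>i. g i = (\<lambda>x. \<Sum>ws\<in>{ws. length ws = t}. c i ws * (\<Prod>j\<leftarrow>ws. x $ j))" by metis
  have "f x = (\<Sum>ws\<in>{ws. length ws = Suc t}. c (hd ws) (tl ws) * (\<Prod>i\<leftarrow>ws. x $ i))" for x
  proof -
    have eq: "{ws :: 'n list. length ws = Suc t} = (\<lambda>p. fst p # snd p) ` (UNIV \<times> {ws. length ws = t})"
    proof (intro equalityI subsetI)
      fix ws :: "'n list" assume "ws \<in> {ws. length ws = Suc t}"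
      then show "ws \<in> (\<lambda>p. fst p # snd p) ` (UNIV \<times> {ws. length ws = t})"
        by (intro image_eqI[of _ _ "(hd ws, tl ws)"]) (cases ws; simp)+
    qed auto
    have "(\<Sum>ws\<in>{ws. length ws = Suc t}. c (hd ws) (tl ws) * (\<Prod>i\<leftarrow>ws. x $ i))
        = (\<Sum>p\<in>UNIV \<times> {ws. length ws = t}. x $ fst p * (c (fst p) (snd p) * (\<Prod>j\<leftarrow>snd p. x $ j)))"
      by (subst eq, subst sum.reindex) (auto simp: inj_on_def prod_eq_iff mult.left_commute)
    also have "\<dots> = (\<Sum>i\<in>UNIV. \<Sum>ws\<in>{ws. length ws = t}. x $ i * (c i ws * (\<Prod>j\<leftarrow>ws. x $ j)))"
      by (simp add: sum.cartesian_product case_prod_unfold)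
    also have "\<dots> = f x"
      by (simp add: g(2) c sum_distrib_left)
    finally show ?thesis by (rule sym)
  qed
  then show ?case by (intro exI[of _ "\<lambda>ws. c (hd ws) (tl ws)"] ext)
qed (auto elim!: forms_0E)

lemma forms_word: "(\<lambda>x. \<Prod>i\<leftarrow>ws. x $ i) \<in> forms (length ws)"
proof (induction ws)
  case (Cons i ws)
  then show ?case using forms_coord_mult[of _ "length ws" i] by simp
qed auto

lemma finite_words: "finite {ws :: 'n::finite list. length ws = t}"
  using finite_lists_length_eq[of "UNIV :: 'n set" t] by simp


subsection \<open>Comparison with the polynomial ring\<close>

lemma eval_poly_superset:
  assumes "finite K" "Poly_Mapping.keys F \<subseteq> K"
  shows "eval_poly F v = (\<Sum>m\<in>K. Poly_Mapping.lookup F m * (\<Prod>i\<in>UNIV. (v $ i) ^ Poly_Mapping.lookup m i))"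
  unfolding eval_poly_def using assms
  by (intro sum.mono_neutral_left) (auto simp: in_keys_iff)

lemma eval_poly_add: "eval_poly (F + G) v = eval_poly F v + eval_poly G v"
proof -
  let ?K = "Poly_Mapping.keys F \<union> Poly_Mapping.keys G"
  have "Poly_Mapping.keys (F + G) \<subseteq> ?K" by (rule Poly_Mapping.keys_add)
  then show ?thesis
    by (simp add: eval_poly_superset[of ?K] lookup_add algebra_simps sum.distrib)
qed

lemma eval_poly_zero: "eval_poly 0 v = 0"
  by (simp add: eval_poly_def)

lemma eval_poly_sum: "eval_poly (\<Sum>k\<in>K. G k) v = (\<Sum>k\<in>K. eval_poly (G k) v)"
  by (induction K rule: infinite_finite_induct) (auto simp: eval_poly_add eval_poly_zero)

lemma homogeneous_add: "homogeneous t F \<Longrightarrow> homogeneous t G \<Longrightarrow> homogeneous t (F + G)"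
  unfolding homogeneous_def using Poly_Mapping.keys_add[of F G] by blast

lemma homogeneous_sum:
  "(\<And>k. k \<in> K \<Longrightarrow> homogeneous t (G k)) \<Longrightarrow> homogeneous t (\<Sum>k\<in>K. G k)"
proof (induction K rule: infinite_finite_induct)
  case (insert k K)
  then show ?case by (simp add: homogeneous_add)
qed (auto simp: homogeneous_def)

lemma eval_poly_in_forms:
  assumes "homogeneous t F" shows "eval_poly F \<in> forms t"
proof -
  have "(\<lambda>v. \<Sum>m\<in>Poly_Mapping.keys F. Poly_Mapping.lookup F m *
      (\<Prod>i\<in>UNIV. (v $ i) ^ Poly_Mapping.lookup m i)) \<in> forms t"
  proof (rule forms_sum, rule forms_cmult)
    fix m assume "m \<in> Poly_Mapping.keys F"
    then have t: "t = (\<Sum>i\<in>UNIV. Poly_Mapping.lookup m i * 1)"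
      using assms by (simp add: homogeneous_def mon_degree_def)
    show "(\<lambda>v. \<Prod>i\<in>UNIV. (v $ i) ^ Poly_Mapping.lookup m i) \<in> forms t"
      by (subst t, rule forms_prod, rule forms_power, rule forms_coord)
  qed
  also have "(\<lambda>v. \<Sum>m\<in>Poly_Mapping.keys F. Poly_Mapping.lookup F m *
      (\<Prod>i\<in>UNIV. (v $ i) ^ Poly_Mapping.lookup m i)) = eval_poly F"
    by (rule ext, rule eval_poly_def[symmetric])
  finally show ?thesis .
qed

lemma eval_poly_single_Suc:
  "eval_poly (Poly_Mapping.single (m + Poly_Mapping.single i 1) c) v =
     v $ i * (c * (\<Prod>j\<in>UNIV. (v $ j) ^ Poly_Mapping.lookup m j))"
proof -
  have "(\<Prod>j\<in>UNIV. (v $ j) ^ Poly_Mapping.lookup (m + Poly_Mapping.single i 1) j)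
      = (\<Prod>j\<in>UNIV. (v $ j) ^ Poly_Mapping.lookup m j * (if j = i then v $ i else 1))"
    by (rule prod.cong) (auto simp: lookup_add lookup_single when_def)
  also have "\<dots> = (\<Prod>j\<in>UNIV. (v $ j) ^ Poly_Mapping.lookup m j) * v $ i"
    by (simp add: prod.distrib)
  finally show ?thesis
    by (subst eval_poly_superset[of "{m + Poly_Mapping.single i 1}"]) auto
qed

lemma mon_degree_Suc: "mon_degree (m + Poly_Mapping.single i 1) = Suc (mon_degree m)"
  by (simp add: mon_degree_def lookup_add lookup_single sum.distrib when_def)

lemma forms_obtain_poly:
  fixes f :: "complex ^ 'n::finite \<Rightarrow> complex"
  assumes "f \<in> forms t"
  obtains G where "homogeneous t G" "f = eval_poly G"
proof -
  have "\<exists>G. homogeneous t G \<and> f = eval_poly G"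
    using assms
  proof (induction t arbitrary: f)
    case 0
    then obtain c where "f = (\<lambda>x. c)" by (auto elim: forms_0E)
    moreover have "eval_poly (Poly_Mapping.single 0 c) = (\<lambda>x :: complex ^ 'n. c)"
      by (rule ext, subst eval_poly_superset[of "{0}"]) auto
    moreover have "homogeneous 0 (Poly_Mapping.single (0 :: 'n \<Rightarrow>\<^sub>0 nat) c)"
      by (auto simp: homogeneous_def mon_degree_def)
    ultimately show ?case by metis
  next
    case (Suc t)
    from Suc.prems obtain g where g: "\<And>i. g i \<in> forms t" "f = (\<lambda>x. \<Sum>i\<in>UNIV. x $ i * g i x)"
    by (rule forms_SucE) blast
    from Suc.IH[OF g(1)] obtain G where
      G: "\<And>i. homogeneous t (G i)" "\<And>i. g i = eval_poly (G i)" by metis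
    define H where "H = (\<Sum>i\<in>UNIV. \<Sum>m\<in>Poly_Mapping.keys (G i).
      Poly_Mapping.single (m + Poly_Mapping.single i 1) (Poly_Mapping.lookup (G i) m))"
    have "homogeneous (Suc t) H"
      unfolding H_def
      by (intro homogeneous_sum) (use G(1) in \<open>auto simp: homogeneous_def mon_degree_Suc[unfolded One_nat_def]\<close>)
    moreover have "f = eval_poly H"
      unfolding H_def g(2) eval_poly_sum eval_poly_single_Suc G(2)
      by (simp add: eval_poly_def sum_distrib_left)
    ultimately show ?case by blast
  qed
  then show ?thesis using that by blast
qed


subsection \<open>Second derivatives\<close>

lemma forms_line_deriv_exists:
  assumes "f \<in> forms t"
  shows "((\<lambda>s. f (x + s *s w)) has_field_derivative dir_deriv w f x) (at 0)"
proof -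
  have "\<exists>D. ((\<lambda>s. f (x + s *s w)) has_field_derivative D) (at 0)"
    using assms
  proof (induction t arbitrary: f)
    case 0
    then show ?case by (auto intro!: exI[of _ 0] elim!: forms_0E)
  next
    case (Suc t)
    from Suc.prems obtain g where g: "\<And>i. g i \<in> forms t" "f = (\<lambda>x. \<Sum>i\<in>UNIV. x $ i * g i x)"
    by (rule forms_SucE) blast
    from Suc.IH[OF g(1)] obtain D where
      D: "\<And>i. ((\<lambda>s. g i (x + s *s w)) has_field_derivative D i) (at 0)" by metis
    show ?case unfolding g(2)
      by (rule exI, rule DERIV_sum) (auto intro!: derivative_eq_intros D)
  qed
  then show ?thesis unfolding dir_deriv_def by (metis DERIV_imp_deriv)
qed


lemma dir_deriv_forms_Suc:
  assumes "\<And>i. g i \<in> forms t"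
  shows "dir_deriv w (\<lambda>x. \<Sum>i\<in>UNIV. x $ i * g i x) =
     (\<lambda>x. (\<Sum>i\<in>UNIV. w $ i * g i x) + (\<Sum>i\<in>UNIV. x $ i * dir_deriv w (g i) x))"
proof
  fix x
  have "((\<lambda>s. (x + s *s w) $ i * g i (x + s *s w)) has_field_derivative
      w $ i * g i x + x $ i * dir_deriv w (g i) x) (at 0)" for i
  proof -
    have "((\<lambda>s. (x + s *s w) $ i) has_field_derivative w $ i) (at 0)"
      by (auto intro!: derivative_eq_intros)
    from DERIV_mult[OF this forms_line_deriv_exists[OF assms]] show ?thesis
      by (simp add: algebra_simps)
  qed
  then have "((\<lambda>s. \<Sum>i\<in>UNIV. (x + s *s w) $ i * g i (x + s *s w)) has_field_derivative
      (\<Sum>i\<in>UNIV. w $ i * g i x + x $ i * dir_deriv w (g i) x)) (at 0)"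
    by (rule DERIV_sum)
  then show "dir_deriv w (\<lambda>x. \<Sum>i\<in>UNIV. x $ i * g i x) x =
      (\<Sum>i\<in>UNIV. w $ i * g i x) + (\<Sum>i\<in>UNIV. x $ i * dir_deriv w (g i) x)"
    unfolding dir_deriv_def sum.distrib by (rule DERIV_imp_deriv)
qed

lemma dir_deriv_const: "dir_deriv w (\<lambda>x. c) = (\<lambda>x. 0)"
  by (rule ext) (simp add: dir_deriv_def)

lemma forms_lincomb:
  assumes "\<And>i. i \<in> I \<Longrightarrow> g i \<in> forms t"
  shows "(\<lambda>x. \<Sum>i\<in>I. c i * g i x) \<in> forms t"
proof (rule forms_sum)
  show "(\<lambda>x. c i * g i x) \<in> forms t" if "i \<in> I" for i
    using forms_cmult[OF assms[OF that], of "c i"] .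
qed

lemma dir_deriv_in_forms:
  assumes "f \<in> forms (Suc t)" shows "dir_deriv w f \<in> forms t"
  using assms
proof (induction t arbitrary: f)
  case 0
  from this obtain g where g: "\<And>i. g i \<in> forms 0" "f = (\<lambda>x. \<Sum>i\<in>UNIV. x $ i * g i x)"
    by (rule forms_SucE) blast
  have "\<forall>i. \<exists>c. g i = (\<lambda>x. c)" using g(1) by (simp add: forms.simps)
  then obtain c where c: "\<And>i. g i = (\<lambda>x. c i)" by (auto dest!: choice)
  show ?case
    unfolding g(2) dir_deriv_forms_Suc[of g, OF g(1)] unfolding c by (simp add: dir_deriv_const)
next
  case (Suc t)
  from this(2) obtain g where g: "\<And>i. g i \<in> forms (Suc t)" "f = (\<lambda>x. \<Sum>i\<in>UNIV. x $ i * g i x)"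
    by (rule forms_SucE) blast
  show ?case unfolding g(2) dir_deriv_forms_Suc[of g, OF g(1)]
    using forms_add[OF forms_lincomb[of UNIV g "Suc t" "\<lambda>i. w $ i"]
        forms_SucI[of "\<lambda>i. dir_deriv w (g i)"]] Suc.IH[OF g(1)] g(1) by blast
qed

lemma dir_deriv_add:
  assumes "f \<in> forms t" "g \<in> forms t"
  shows "dir_deriv w (\<lambda>x. f x + g x) = (\<lambda>x. dir_deriv w f x + dir_deriv w g x)"
  by (rule ext, subst dir_deriv_def, rule DERIV_imp_deriv)
    (rule DERIV_add[OF forms_line_deriv_exists[OF assms(1)] forms_line_deriv_exists[OF assms(2)]])

lemma dir_deriv_lincomb:
  assumes "\<And>i. i \<in> I \<Longrightarrow> g i \<in> forms t"
  shows "dir_deriv w (\<lambda>x. \<Sum>i\<in>I. c i * g i x) = (\<lambda>x. \<Sum>i\<in>I. c i * dir_deriv w (g i) x)"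
  by (rule ext, subst dir_deriv_def, rule DERIV_imp_deriv, rule DERIV_sum, rule DERIV_cmult)
    (erule forms_line_deriv_exists[OF assms])

text \<open>
  Differentiating \<open>\<Sum> x\<^sub>i g\<^sub>i\<close> twice gives two sums of first derivatives of the \<open>g\<^sub>i\<close>, which the exchange of
  \<open>v\<close> and \<open>w\<close> swaps, and a sum of second derivatives, to which the induction hypothesis applies.
\<close>

lemma dir_deriv_commute:
  assumes "f \<in> forms t"
  shows "dir_deriv v (dir_deriv w f) = dir_deriv w (dir_deriv v f)"
  using assms
proof (induction t arbitrary: f)
  case 0
  then show ?case by (auto simp: dir_deriv_const elim!: forms_0E)
next
  case (Suc t)
  from Suc.prems obtain g where g: "\<And>i. g i \<in> forms t" "f = (\<lambda>x. \<Sum>i\<in>UNIV. x $ i * g i x)"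
    by (rule forms_SucE) blast
  show ?case
  proof (cases t)
    case 0
    then have "\<forall>i. \<exists>c. g i = (\<lambda>x. c)" using g(1) by (simp add: forms.simps)
    then obtain c where c: "\<And>i. g i = (\<lambda>x. c i)" by (auto dest!: choice)
    show ?thesis
      unfolding g(2) dir_deriv_forms_Suc[of g, OF g(1)] unfolding c by (simp add: dir_deriv_const)
  next
    case (Suc t')
    have g': "dir_deriv u (g i) \<in> forms t'" for u i
      using g(1) Suc dir_deriv_in_forms by blast
    have *: "dir_deriv v (dir_deriv w f) = (\<lambda>x. (\<Sum>i\<in>UNIV. w $ i * dir_deriv v (g i) x) +
       ((\<Sum>i\<in>UNIV. v $ i * dir_deriv w (g i) x) +
         (\<Sum>i\<in>UNIV. x $ i * dir_deriv v (dir_deriv w (g i)) x)))" for v w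
    proof -
      have 1: "(\<lambda>x. \<Sum>i\<in>UNIV. w $ i * g i x) \<in> forms (Suc t')"
        using forms_lincomb[of UNIV g t "\<lambda>i. w $ i"] g(1) Suc by simp
      have 2: "(\<lambda>x. \<Sum>i\<in>UNIV. x $ i * dir_deriv w (g i) x) \<in> forms (Suc t')"
        using forms_SucI[of "\<lambda>i. dir_deriv w (g i)", OF g'] .
      show ?thesis
        unfolding g(2) dir_deriv_forms_Suc[of g, OF g(1)] dir_deriv_add[OF 1 2]
          dir_deriv_lincomb[of _ g, OF g(1)] dir_deriv_forms_Suc[of "\<lambda>i. dir_deriv w (g i)", OF g'] by simp
    qed
    show ?thesis unfolding * Suc.IH[OF g(1)] by (simp add: algebra_simps)
  qed
qed


section \<open>The projective Nullstellensatz\<close>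

subsection \<open>Homogeneous linear systems\<close>

lemma linear_system_nontrivial:
  fixes M :: "'i \<Rightarrow> 's \<Rightarrow> 'a::field"
  assumes "finite S" "finite I" "card S < card I"
  shows "\<exists>c. (\<exists>i\<in>I. c i \<noteq> 0) \<and> (\<forall>s\<in>S. (\<Sum>i\<in>I. c i * M i s) = 0)"
  using assms
proof (induction S arbitrary: I M rule: finite_induct)
  case empty
  then have "I \<noteq> {}" by auto
  then show ?case by (intro exI[of _ "\<lambda>_. 1"]) auto
next
  case (insert s S)
  show ?case
  proof (cases "\<forall>i\<in>I. M i s = 0")
    case True
    from insert.hyps insert.prems have "card S < card I" by simp
    from insert.IH[OF insert.prems(1) this, of M] obtain c where
      "\<exists>i\<in>I. c i \<noteq> 0" "\<forall>s\<in>S. (\<Sum>i\<in>I. c i * M i s) = 0" by blast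
    with True show ?thesis by (intro exI[of _ c]) auto
  next
    case False
    then obtain k where k: "k \<in> I" "M k s \<noteq> 0" by blast
    \<comment> \<open>eliminate the unknown \<open>k\<close> with the help of equation \<open>s\<close>\<close>
    define M' where "M' i s' = M i s' - M i s / M k s * M k s'" for i s'
    have "card S < card (I - {k})" using insert k by simp
    from insert.IH[OF _ this, of M'] insert.prems obtain c where
      c: "\<exists>i\<in>I - {k}. c i \<noteq> 0" "\<And>s'. s' \<in> S \<Longrightarrow> (\<Sum>i\<in>I - {k}. c i * M' i s') = 0" by auto
    define c' where "c' i = (if i = k then - (\<Sum>i\<in>I - {k}. c i * M i s) / M k s else c i)" for i
    have eq: "(\<Sum>i\<in>I. c' i * M i s') = (\<Sum>i\<in>I - {k}. c i * M' i s')" for s'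
    proof -
      have "(\<Sum>i\<in>I. c' i * M i s') = c' k * M k s' + (\<Sum>i\<in>I - {k}. c' i * M i s')"
        using insert.prems k by (subst sum.remove[of _ k]) auto
      also have "(\<Sum>i\<in>I - {k}. c' i * M i s') = (\<Sum>i\<in>I - {k}. c i * M i s')"
        by (rule sum.cong) (auto simp: c'_def)
      also have "c' k * M k s' = - (\<Sum>i\<in>I - {k}. c i * (M i s / M k s * M k s'))"
        by (simp add: c'_def sum_distrib_left sum_distrib_right sum_divide_distrib sum_negf mult.assoc)
      also have "\<dots> + (\<Sum>i\<in>I - {k}. c i * M i s') = (\<Sum>i\<in>I - {k}. c i * M' i s')"
        by (simp add: M'_def right_diff_distrib sum_subtractf)
      finally show ?thesis .
    qed
    have "M' i s = 0" for i using k by (simp add: M'_def)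
    then have "(\<Sum>i\<in>I. c' i * M i s) = 0" unfolding eq by simp
    moreover have "\<exists>i\<in>I. c' i \<noteq> 0" using c(1) by (auto simp: c'_def)
    ultimately show ?thesis using c(2) by (intro exI[of _ c']) (auto simp: eq)
  qed
qed


subsection \<open>Graded ideals\<close>

text \<open>
  A homogeneous ideal is recorded as the set of pairs of a degree and a member of that degree, so
  that the zero function may occur in every degree without ambiguity.
\<close>

definition graded_ideal :: "(nat \<times> (complex ^ 'n::finite \<Rightarrow> complex)) set \<Rightarrow> bool" where
  "graded_ideal P \<longleftrightarrow>
     (\<forall>t f. (t, f) \<in> P \<longrightarrow> f \<in> forms t) \<and> (\<forall>t. (t, \<lambda>x. 0) \<in> P) \<and>
     (\<forall>t f g. (t, f) \<in> P \<longrightarrow> (t, g) \<in> P \<longrightarrow> (t, \<lambda>x. f x + g x) \<in> P) \<and>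
     (\<forall>t f u g. (t, f) \<in> P \<longrightarrow> g \<in> forms u \<longrightarrow> (t + u, \<lambda>x. f x * g x) \<in> P)"

definition contains_degree :: "(nat \<times> (complex ^ 'n::finite \<Rightarrow> complex)) set \<Rightarrow> nat \<Rightarrow> bool" where
  "contains_degree P t \<longleftrightarrow> (\<forall>f\<in>forms t. (t, f) \<in> P)"

context
  fixes P :: "(nat \<times> (complex ^ 'n::finite \<Rightarrow> complex)) set"
  assumes P: "graded_ideal P"
begin

lemma ideal_forms: "(t, f) \<in> P \<Longrightarrow> f \<in> forms t"
  using P unfolding graded_ideal_def by blast

lemma ideal_zero: "(t, \<lambda>x. 0) \<in> P"
  using P unfolding graded_ideal_def by blast

lemma ideal_add: "(t, f) \<in> P \<Longrightarrow> (t, g) \<in> P \<Longrightarrow> (t, \<lambda>x. f x + g x) \<in> P"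
  using P unfolding graded_ideal_def by blast

lemma ideal_mult: "(t, f) \<in> P \<Longrightarrow> g \<in> forms u \<Longrightarrow> v = t + u \<Longrightarrow> (v, \<lambda>x. f x * g x) \<in> P"
  using P unfolding graded_ideal_def by blast

lemma ideal_cmult: "(t, f) \<in> P \<Longrightarrow> (t, \<lambda>x. c * f x) \<in> P"
  using ideal_mult[of t f "\<lambda>x. c" 0 t] by (simp add: mult.commute)

lemma ideal_sum:
  assumes "\<And>i. i \<in> I \<Longrightarrow> (t, f i) \<in> P" shows "(t, \<lambda>x. \<Sum>i\<in>I. f i x) \<in> P"
  using assms by (induction I rule: infinite_finite_induct) (auto intro: ideal_zero ideal_add)

lemma contains_degree_Suc:
  assumes "contains_degree P t" shows "contains_degree P (Suc t)"
  unfolding contains_degree_def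
proof
  fix f :: "complex ^ 'n \<Rightarrow> complex" assume "f \<in> forms (Suc t)"
  then obtain g where g: "\<And>i. g i \<in> forms t" "f = (\<lambda>x. \<Sum>i\<in>UNIV. x $ i * g i x)"
    by (rule forms_SucE) blast
  have "(Suc t, \<lambda>x. x $ i * g i x) \<in> P" for i
    using assms g(1) ideal_mult[of t "g i" "\<lambda>x. x $ i" 1] forms_coord[of i]
    by (simp add: contains_degree_def mult.commute)
  then show "(Suc t, f) \<in> P" unfolding g(2) by (rule ideal_sum)
qed

lemma contains_degree_mono: "contains_degree P t \<Longrightarrow> t \<le> u \<Longrightarrow> contains_degree P u"
  by (rule dec_induct[of t u]) (auto intro: contains_degree_Suc)

lemma contains_degree_products:
  assumes "\<And>f g. f \<in> forms t \<Longrightarrow> g \<in> forms u \<Longrightarrow> (t + u, \<lambda>x. f x * g x) \<in> P"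
  shows "contains_degree P (t + u)"
  unfolding contains_degree_def
proof
  fix f :: "complex ^ 'n \<Rightarrow> complex" assume "f \<in> forms (t + u)"
  then obtain c where c: "f = (\<lambda>x. \<Sum>ws\<in>{ws. length ws = t + u}. c ws * (\<Prod>i\<leftarrow>ws. x $ i))"
    using forms_word_expansion by blast
  have "(t + u, \<lambda>x. \<Prod>i\<leftarrow>ws. x $ i) \<in> P" if "length ws = t + u" for ws
  proof -
    have "(\<lambda>x :: complex ^ 'n. \<Prod>i\<leftarrow>take t ws. x $ i) \<in> forms t"
      "(\<lambda>x :: complex ^ 'n. \<Prod>i\<leftarrow>drop t ws. x $ i) \<in> forms u"
      using forms_word[of "take t ws"] forms_word[of "drop t ws"] that by simp_all
    from assms[OF this] show ?thesis
      by (simp flip: prod_list.append map_append)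
  qed
  then show "(t + u, f) \<in> P"
    unfolding c by (intro ideal_sum ideal_cmult) auto
qed

end

text \<open>The ideal quotient of \<open>P\<close> by \<open>K\<close>, where \<open>K\<close> consists of forms of degree \<open>a\<close>.\<close>

definition colon :: "(nat \<times> (complex ^ 'n::finite \<Rightarrow> complex)) set \<Rightarrow> nat \<Rightarrow>
    (complex ^ 'n \<Rightarrow> complex) set \<Rightarrow> (nat \<times> (complex ^ 'n \<Rightarrow> complex)) set" where
  "colon P a K = {(t, h). h \<in> forms t \<and> (\<forall>k\<in>K. (a + t, \<lambda>x. k x * h x) \<in> P)}"

lemma graded_ideal_colon:
  fixes P :: "(nat \<times> (complex ^ 'n::finite \<Rightarrow> complex)) set"
  assumes P: "graded_ideal P" shows "graded_ideal (colon P a K)"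
  unfolding graded_ideal_def
proof (intro conjI allI impI)
  fix t f u and g :: "complex ^ 'n \<Rightarrow> complex" assume *: "(t, f) \<in> colon P a K" "g \<in> forms u"
  then have "(a + (t + u), \<lambda>x. k x * (f x * g x)) \<in> P" if "k \<in> K" for k
    using that ideal_mult[OF P, of "a + t" "\<lambda>x. k x * f x" g u]
    by (simp add: colon_def mult.assoc add.assoc)
  with * show "(t + u, \<lambda>x. f x * g x) \<in> colon P a K"
    by (auto simp: colon_def intro: forms_mult)
next
  fix t f g assume *: "(t, f) \<in> colon P a K" "(t, g) \<in> colon P a K"
  then have "(a + t, \<lambda>x. k x * (f x + g x)) \<in> P" if "k \<in> K" for k
    using that ideal_add[OF P, of "a + t" "\<lambda>x. k x * f x" "\<lambda>x. k x * g x"]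
    by (simp add: colon_def distrib_left)
  with * show "(t, \<lambda>x. f x + g x) \<in> colon P a K"
    by (auto simp: colon_def intro: forms_add)
qed (auto simp: colon_def ideal_zero[OF P])

lemma colon_superset:
  assumes P: "graded_ideal P" and K: "K \<subseteq> forms a" shows "P \<subseteq> colon P a K"
proof (rule subrelI)
  fix t h assume h: "(t, h) \<in> P"
  have "(a + t, \<lambda>x. k x * h x) \<in> P" if "k \<in> K" for k
    using ideal_mult[OF P h, of k a "a + t"] that K by (auto simp: mult.commute)
  with h show "(t, h) \<in> colon P a K" by (auto simp: colon_def ideal_forms[OF P])
qed

definition ideal_plus_linear :: "(nat \<times> (complex ^ 'n::finite \<Rightarrow> complex)) set \<Rightarrow>
    (complex ^ 'n \<Rightarrow> complex) \<Rightarrow> (nat \<times> (complex ^ 'n \<Rightarrow> complex)) set" where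
  "ideal_plus_linear P l = {(t, h). \<exists>m g. (t, m) \<in> P \<and> h = (\<lambda>x. m x + l x * g x) \<and>
     (g = (\<lambda>x. 0) \<or> (\<exists>u. t = Suc u \<and> g \<in> forms u))}"

lemma ideal_plus_linearI:
  assumes "(t, m) \<in> P" "\<And>x. h x = m x + l x * g x"
    "g = (\<lambda>x. 0) \<or> (\<exists>u. t = Suc u \<and> g \<in> forms u)"
  shows "(t, h) \<in> ideal_plus_linear P l"
proof -
  have "h = (\<lambda>x. m x + l x * g x)" using assms(2) by (rule ext)
  with assms(1,3) have "\<exists>m g. (t, m) \<in> P \<and> h = (\<lambda>x. m x + l x * g x) \<and>
     (g = (\<lambda>x. 0) \<or> (\<exists>u. t = Suc u \<and> g \<in> forms u))" by (intro exI conjI)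
  then show ?thesis by (simp add: ideal_plus_linear_def)
qed

lemma ideal_plus_linearE:
  assumes "(t, h) \<in> ideal_plus_linear P l"
  obtains m g where "(t, m) \<in> P" "h = (\<lambda>x. m x + l x * g x)"
    "g = (\<lambda>x. 0) \<or> (\<exists>u. t = Suc u \<and> g \<in> forms u)"
proof -
  from assms have "\<exists>m g. (t, m) \<in> P \<and> h = (\<lambda>x. m x + l x * g x) \<and>
     (g = (\<lambda>x. 0) \<or> (\<exists>u. t = Suc u \<and> g \<in> forms u))" by (simp add: ideal_plus_linear_def)
  then show ?thesis by (elim exE conjE) (rule that)
qed

lemma graded_ideal_plus_linear:
  fixes P :: "(nat \<times> (complex ^ 'n::finite \<Rightarrow> complex)) set"
  assumes P: "graded_ideal P" and l: "l \<in> forms 1" shows "graded_ideal (ideal_plus_linear P l)"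
  unfolding graded_ideal_def
proof (intro conjI allI impI)
  fix t f assume "(t, f) \<in> ideal_plus_linear P l"
  then obtain m g where *: "(t, m) \<in> P" "f = (\<lambda>x. m x + l x * g x)"
     "g = (\<lambda>x. 0) \<or> (\<exists>u. t = Suc u \<and> g \<in> forms u)"
    by (rule ideal_plus_linearE)
  have "(\<lambda>x. l x * g x) \<in> forms t" using *(3) forms_mult[OF l, of g] by auto
  with * ideal_forms[OF P *(1)] show "f \<in> forms t" by (simp add: forms_add)
next
  fix t show "(t, \<lambda>x. 0) \<in> ideal_plus_linear P l"
    by (rule ideal_plus_linearI[OF ideal_zero[OF P], of _ _ "\<lambda>x. 0"]) auto
next
  fix t f f' assume "(t, f) \<in> ideal_plus_linear P l" "(t, f') \<in> ideal_plus_linear P l"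
  then obtain m g m' g' where *: "(t, m) \<in> P" "f = (\<lambda>x. m x + l x * g x)"
     "g = (\<lambda>x. 0) \<or> (\<exists>u. t = Suc u \<and> g \<in> forms u)" "(t, m') \<in> P" "f' = (\<lambda>x. m' x + l x * g' x)"
     "g' = (\<lambda>x. 0) \<or> (\<exists>u. t = Suc u \<and> g' \<in> forms u)"
    by (elim ideal_plus_linearE)
  show "(t, \<lambda>x. f x + f' x) \<in> ideal_plus_linear P l"
  proof (rule ideal_plus_linearI[OF ideal_add[OF P *(1,4)]])
    show "f x + f' x = (m x + m' x) + l x * (g x + g' x)" for x
      by (simp add: *(2,5) algebra_simps)
    show "(\<lambda>x. g x + g' x) = (\<lambda>x. 0) \<or> (\<exists>u. t = Suc u \<and> (\<lambda>x. g x + g' x) \<in> forms u)"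
      using *(3,6) by (auto intro: forms_add)
  qed
next
  fix t f v and k :: "complex ^ 'n \<Rightarrow> complex"
  assume "(t, f) \<in> ideal_plus_linear P l" and k: "k \<in> forms v"
  from this(1) obtain m g where *: "(t, m) \<in> P" "f = (\<lambda>x. m x + l x * g x)"
     "g = (\<lambda>x. 0) \<or> (\<exists>u. t = Suc u \<and> g \<in> forms u)"
    by (rule ideal_plus_linearE)
  show "(t + v, \<lambda>x. f x * k x) \<in> ideal_plus_linear P l"
  proof (rule ideal_plus_linearI[OF ideal_mult[OF P *(1) k refl]])
    show "f x * k x = m x * k x + l x * (g x * k x)" for x
      by (simp add: *(2) algebra_simps)
    show "(\<lambda>x. g x * k x) = (\<lambda>x. 0) \<or> (\<exists>u. t + v = Suc u \<and> (\<lambda>x. g x * k x) \<in> forms u)"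
      using *(3) forms_mult[OF _ k] by auto
  qed
qed


subsection \<open>Maximal relevant ideals are points\<close>

text \<open>
  Among the graded ideals that contain no full degree there is a maximal one, by Zorn's lemma. It will
  turn out to be the ideal of a single point of projective space.
\<close>

lemma maximal_relevant_exists:
  fixes P :: "(nat \<times> (complex ^ 'n::finite \<Rightarrow> complex)) set"
  assumes P: "graded_ideal P" and rel: "\<And>t. \<not> contains_degree P t"
  shows "\<exists>M. graded_ideal M \<and> P \<subseteq> M \<and> (\<forall>t. \<not> contains_degree M t) \<and>
    (\<forall>Q. graded_ideal Q \<longrightarrow> M \<subseteq> Q \<longrightarrow> (\<forall>t. \<not> contains_degree Q t) \<longrightarrow> Q = M)"
proof -
  define \<A> where "\<A> = {Q. graded_ideal Q \<and> P \<subseteq> Q \<and> (\<forall>t. \<not> contains_degree Q t)}"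
  have "\<exists>M\<in>\<A>. \<forall>X\<in>\<A>. M \<subseteq> X \<longrightarrow> X = M"
  proof (rule subset_Zorn_nonempty)
    show "\<A> \<noteq> {}" using assms by (auto simp: \<A>_def)
  next
    fix C assume C: "C \<noteq> {}" "subset.chain \<A> C"
    have CA: "\<And>Q. Q \<in> C \<Longrightarrow> Q \<in> \<A>" and lin: "\<And>Q R. Q \<in> C \<Longrightarrow> R \<in> C \<Longrightarrow> Q \<subseteq> R \<or> R \<subseteq> Q"
      using C(2) by (auto simp: subset_chain_def)
    have gr: "graded_ideal Q" if "Q \<in> C" for Q using CA[OF that] by (simp add: \<A>_def)
    have U: "graded_ideal (\<Union>C)"
      unfolding graded_ideal_def
    proof (intro conjI allI impI)
      fix t f g assume "(t, f) \<in> \<Union>C" "(t, g) \<in> \<Union>C"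
      then obtain Q where "Q \<in> C" "(t, f) \<in> Q" "(t, g) \<in> Q" using lin by blast
      then show "(t, \<lambda>x. f x + g x) \<in> \<Union>C" using ideal_add[OF gr] by blast
    next
      fix t f u and g :: "complex ^ 'n \<Rightarrow> complex" assume "(t, f) \<in> \<Union>C" "g \<in> forms u"
      then show "(t + u, \<lambda>x. f x * g x) \<in> \<Union>C" using ideal_mult[OF gr] by blast
    next
      fix t show "(t, \<lambda>x. 0) \<in> \<Union>C" using C(1) ideal_zero[OF gr] by blast
    qed (use ideal_forms[OF gr] in blast)
    \<comment> \<open>a degree contained in the union is spanned by finitely many words, hence contained in one member\<close>
    have "\<not> contains_degree (\<Union>C) t" for t
    proof
      assume t: "contains_degree (\<Union>C) t"
      let ?W = "(\<lambda>ws. (t, \<lambda>x :: complex ^ 'n. \<Prod>i\<leftarrow>ws. x $ i)) ` {ws. length ws = t}"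
      have "?W \<subseteq> \<Union>C" using t forms_word by (auto simp: contains_degree_def)
      with finite_words[of t] obtain Q where Q: "Q \<in> C" "?W \<subseteq> Q"
        using finite_subset_Union_chain[of ?W C \<A>] C by blast
      have "contains_degree Q t"
        unfolding contains_degree_def
      proof
        fix f :: "complex ^ 'n \<Rightarrow> complex" assume "f \<in> forms t"
        then obtain c where c: "f = (\<lambda>x. \<Sum>ws\<in>{ws. length ws = t}. c ws * (\<Prod>i\<leftarrow>ws. x $ i))"
          using forms_word_expansion by blast
        show "(t, f) \<in> Q"
          unfolding c using Q by (intro ideal_sum[OF gr] ideal_cmult[OF gr]) auto
      qed
      then show False using CA[OF Q(1)] by (simp add: \<A>_def)
    qed
    moreover have "P \<subseteq> \<Union>C" using C(1) CA by (auto simp: \<A>_def)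
    ultimately show "\<Union>C \<in> \<A>" using U by (simp add: \<A>_def)
  qed
  then obtain M where M: "M \<in> \<A>" "\<And>X. X \<in> \<A> \<Longrightarrow> M \<subseteq> X \<Longrightarrow> X = M" by blast
  have "Q = M" if "graded_ideal Q" "M \<subseteq> Q" "\<forall>t. \<not> contains_degree Q t" for Q
    by (rule M(2)) (use that M(1) in \<open>auto simp: \<A>_def\<close>)
  moreover have "graded_ideal M" "P \<subseteq> M" "\<forall>t. \<not> contains_degree M t"
    using M(1) by (auto simp: \<A>_def)
  ultimately show ?thesis by (intro exI[of _ M]) simp
qed

text \<open>The homogenization of \<open>p\<close> in degree \<open>h\<close>, evaluated at \<open>(a, b)\<close>.\<close>

definition binary_form :: "complex poly \<Rightarrow> nat \<Rightarrow> complex \<Rightarrow> complex \<Rightarrow> complex" where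
  "binary_form p h a b = (\<Sum>j\<le>h. coeff p j * (a ^ j * b ^ (h - j)))"

lemma binary_form_low_degree:
  assumes "degree p \<le> h" shows "binary_form p (Suc h) a b = b * binary_form p h a b"
  using assms by (simp add: binary_form_def coeff_eq_0 sum_distrib_left Suc_diff_le mult_ac)

lemma binary_form_linear_factor:
  assumes "degree q \<le> h"
  shows "binary_form ([:-z, 1:] * q) (Suc h) a b = (a - z * b) * binary_form q h a b"
proof -
  have "binary_form (pCons 0 q) (Suc h) a b = a * binary_form q h a b"
    unfolding binary_form_def by (subst sum.atMost_Suc_shift) (simp add: sum_distrib_left mult_ac)
  moreover have "binary_form ([:-z, 1:] * q) (Suc h) a b =
      binary_form (pCons 0 q) (Suc h) a b - z * binary_form q (Suc h) a b"
    by (simp add: binary_form_def sum_distrib_left algebra_simps sum.distrib sum_negf sum_subtractf)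
  ultimately show ?thesis
    by (simp add: binary_form_low_degree[OF assms] algebra_simps)
qed

context
  fixes M :: "(nat \<times> (complex ^ 'n::finite \<Rightarrow> complex)) set"
  assumes M: "graded_ideal M" and rel: "\<And>t. \<not> contains_degree M t"
    and maximal: "\<And>Q. graded_ideal Q \<Longrightarrow> M \<subseteq> Q \<Longrightarrow> (\<And>t. \<not> contains_degree Q t) \<Longrightarrow> Q = M"
begin

text \<open>
  If \<open>g\<close> is not in \<open>M\<close>, then the quotient \<open>M : f\<close> is strictly larger than \<open>M\<close> and contains all forms of some
  degree \<open>u\<close>. If \<open>f\<close> is not in \<open>M\<close> either, the quotient of \<open>M\<close> by the forms of degree \<open>u\<close> is also strictly
  larger and contains a degree \<open>t\<close>; but then \<open>M\<close> contains the degree \<open>u + t\<close>.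
\<close>

lemma maximal_relevant_prime:
  assumes f: "f \<in> forms a" and g: "g \<in> forms b" and fg: "(a + b, \<lambda>x. f x * g x) \<in> M"
  shows "(a, f) \<in> M \<or> (b, g) \<in> M"
proof (rule ccontr)
  assume neg: "\<not> ((a, f) \<in> M \<or> (b, g) \<in> M)"
  have "(b, g) \<in> colon M a {f}" using fg g by (simp add: colon_def)
  with neg maximal[OF graded_ideal_colon[OF M] colon_superset[OF M]] f obtain u where
    "contains_degree (colon M a {f}) u" by blast
  then have u: "(u + a, \<lambda>x. k x * f x) \<in> M" if "k \<in> forms u" for k
    using that by (auto simp: contains_degree_def colon_def mult.commute add.commute)
  then have "(a, f) \<in> colon M u (forms u)" using f by (simp add: colon_def)
  with neg maximal[OF graded_ideal_colon[OF M] colon_superset[OF M]] obtain t where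
    "contains_degree (colon M u (forms u)) t" by blast
  then have "contains_degree M (u + t)"
    by (intro contains_degree_products[OF M]) (auto simp: contains_degree_def colon_def)
  with rel show False by blast
qed

lemma const_notin_maximal: "c \<noteq> 0 \<Longrightarrow> (0, \<lambda>x. c) \<notin> M"
proof
  assume c: "c \<noteq> 0" "(0, \<lambda>x. c) \<in> M"
  have "(0, \<lambda>x. b) \<in> M" for b
    using ideal_cmult[OF M c(2), of "b / c"] c(1) by simp
  then have "contains_degree M 0"
    unfolding contains_degree_def by (auto elim!: forms_0E)
  with rel show False by blast
qed

lemma power_notin_maximal:
  assumes "l \<in> forms 1" "(1, l) \<notin> M" shows "(k, \<lambda>x. l x ^ k) \<notin> M"
proof (induction k)
  case 0
  then show ?case using const_notin_maximal[of 1] by simp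
next
  case (Suc k)
  then show ?case
    using maximal_relevant_prime[OF assms(1) forms_power[OF assms(1), of k]] assms by auto
qed

text \<open>The binary form splits into linear factors over the complex numbers, and \<open>M\<close> is prime.\<close>

lemma binary_form_factor_in_maximal:
  assumes f: "f \<in> forms 1" and l: "l \<in> forms 1" "(1, l) \<notin> M"
    and p: "p \<noteq> 0" "degree p \<le> h" "(h, \<lambda>x. binary_form p h (f x) (l x)) \<in> M"
  shows "\<exists>c. (1, \<lambda>x. f x - c * l x) \<in> M"
  using p
proof (induction h arbitrary: p)
  case 0
  then obtain c where "p = [:c:]" "c \<noteq> 0" by (auto elim: degree_eq_zeroE)
  with 0 const_notin_maximal[of c] show ?case by (simp add: binary_form_def)
next
  case (Suc h)
  have bf: "(\<lambda>x. binary_form q h (f x) (l x)) \<in> forms h" for q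
    unfolding binary_form_def
  proof (rule forms_lincomb)
    fix j assume "j \<in> {..h}"
    then show "(\<lambda>x. f x ^ j * l x ^ (h - j)) \<in> forms h"
      using forms_mult[OF forms_power[OF f, of j] forms_power[OF l(1), of "h - j"]] by simp
  qed
  show ?case
  proof (cases "degree p \<le> h")
    case True
    with Suc.prems(3) have "(1 + h, \<lambda>x. l x * binary_form p h (f x) (l x)) \<in> M"
      by (simp add: binary_form_low_degree)
    with maximal_relevant_prime[OF l(1) bf] l(2) have "(h, \<lambda>x. binary_form p h (f x) (l x)) \<in> M" by blast
    with Suc.IH Suc.prems True show ?thesis by blast
  next
    case False
    then have deg: "degree p = Suc h" using Suc.prems by simp
    then have "\<not> constant (poly p)" by (simp add: constant_degree)
    then obtain z where "poly p z = 0" using fundamental_theorem_of_algebra by blast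
    then obtain q where q: "p = [:-z, 1:] * q" by (auto simp: poly_eq_0_iff_dvd elim: dvdE)
    with Suc.prems(1) have "q \<noteq> 0" by auto
    with deg have dq: "degree q = h" unfolding q by (subst (asm) degree_mult_eq) auto
    have "(1 + h, \<lambda>x. (f x - z * l x) * binary_form q h (f x) (l x)) \<in> M"
      using Suc.prems(3) unfolding q by (subst (asm) binary_form_linear_factor) (auto simp: dq)
    moreover have "(\<lambda>x. f x - z * l x) \<in> forms 1"
      using forms_add[OF f forms_cmult[OF l(1), of "-z"]] by simp
    ultimately have "(1, \<lambda>x. f x - z * l x) \<in> M \<or> (h, \<lambda>x. binary_form q h (f x) (l x)) \<in> M"
      using maximal_relevant_prime bf by blast
    with Suc.IH[of q] \<open>q \<noteq> 0\<close> dq show ?thesis by auto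
  qed
qed

lemma coordinate_notin_maximal: "\<exists>i. (1, \<lambda>x. x $ i) \<notin> M"
proof (rule ccontr)
  assume *: "\<not> ?thesis"
  have "contains_degree M 1"
    unfolding contains_degree_def
  proof
    fix f :: "complex ^ 'n \<Rightarrow> complex" assume "f \<in> forms 1"
    then have "f \<in> forms (Suc 0)" by simp
    then obtain g where g: "\<And>i. g i \<in> forms 0" "f = (\<lambda>x. \<Sum>i\<in>UNIV. x $ i * g i x)"
      by (rule forms_SucE) blast
    have "(1, \<lambda>x. x $ i * g i x) \<in> M" for i
      using * g(1) ideal_mult[OF M, of 1 "\<lambda>x. x $ i" "g i" 0 1] by simp
    then show "(1, f) \<in> M" unfolding g(2) by (rule ideal_sum[OF M])
  qed
  with rel show False by blast
qed

text \<open>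
  Maximality makes multiplication by \<open>l\<close> surjective on the residue ring in large degrees, so that the
  graded pieces of the residue ring have bounded dimension.
\<close>

lemma forms_mod_maximal:
  assumes l: "l \<in> forms 1" "(1, l) \<notin> M"
  obtains t where "\<And>s f. f \<in> forms (t + s) \<Longrightarrow> \<exists>g\<in>forms t. (t + s, \<lambda>x. f x - l x ^ s * g x) \<in> M"
proof -
  have "(1, l) \<in> ideal_plus_linear M l"
    by (rule ideal_plus_linearI[OF ideal_zero[OF M], of _ _ "\<lambda>x. 1"]) auto
  moreover have "M \<subseteq> ideal_plus_linear M l"
    by (rule subrelI, rule ideal_plus_linearI[of _ _ _ _ _ "\<lambda>x. 0"]) auto
  ultimately obtain t where t: "contains_degree (ideal_plus_linear M l) t"
    using maximal[OF graded_ideal_plus_linear[OF M l(1)]] l(2) by blast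
  have "\<exists>g\<in>forms t. (t + s, \<lambda>x. f x - l x ^ s * g x) \<in> M" if "f \<in> forms (t + s)" for f s
    using that
  proof (induction s arbitrary: f)
    case 0
    then show ?case using ideal_zero[OF M] by (intro bexI[of _ f]) auto
  next
    case (Suc s)
    have "contains_degree (ideal_plus_linear M l) (t + Suc s)"
      using contains_degree_mono[OF graded_ideal_plus_linear[OF M l(1)] t] by simp
    with Suc.prems have "(t + Suc s, f) \<in> ideal_plus_linear M l"
      by (simp add: contains_degree_def)
    then obtain m k where mk: "(t + Suc s, m) \<in> M" "f = (\<lambda>x. m x + l x * k x)"
      "k = (\<lambda>x. 0) \<or> (\<exists>u. t + Suc s = Suc u \<and> k \<in> forms u)"
      by (rule ideal_plus_linearE)
    from mk(3) have "k \<in> forms (t + s)" by auto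
    from Suc.IH[OF this] obtain g where g: "g \<in> forms t" "(t + s, \<lambda>x. k x - l x ^ s * g x) \<in> M" by blast
    have "(t + Suc s, \<lambda>x. (k x - l x ^ s * g x) * l x) \<in> M"
      using ideal_mult[OF M g(2) l(1)] by simp
    from ideal_add[OF M mk(1) this]
    have "(t + Suc s, \<lambda>x. f x - l x ^ Suc s * g x) \<in> M"
      by (simp add: mk(2) algebra_simps)
    with g(1) show ?case by blast
  qed
  with that show ?thesis by blast
qed

text \<open>
  By bounded dimension the products \<open>f\<^sup>j l\<^sup>h\<^sup>-\<^sup>j\<close> are linearly dependent modulo \<open>M\<close> for large \<open>h\<close>, and
  the dependence is a binary form, which splits into linear factors.
\<close>

lemma linear_forms_proportional_mod_maximal:
  assumes f: "f \<in> forms 1" and l: "l \<in> forms 1" "(1, l) \<notin> M"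
  shows "\<exists>c. (1, \<lambda>x. f x - c * l x) \<in> M"
proof -
  obtain t where t: "\<And>s f. f \<in> forms (t + s) \<Longrightarrow> \<exists>g\<in>forms t. (t + s, \<lambda>x. f x - l x ^ s * g x) \<in> M"
    using forms_mod_maximal[OF l] by blast
  define W where "W = {ws :: 'n list. length ws = t}"
  \<comment> \<open>this gives \<open>h + 1 > card W\<close> products in degree \<open>h\<close>, against \<open>card W\<close> generators modulo \<open>M\<close>\<close>
  define s where "s = card W"
  define h where "h = t + s"
  define R where "R j e \<longleftrightarrow>
      (h, \<lambda>x. f x ^ j * l x ^ (h - j) - l x ^ s * (\<Sum>ws\<in>W. e ws * (\<Prod>i\<leftarrow>ws. x $ i))) \<in> M" for j e
  have "\<exists>e. R j e" if "j \<le> h" for j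
  proof -
    have "(\<lambda>x. f x ^ j * l x ^ (h - j)) \<in> forms (t + s)"
      using forms_mult[OF forms_power[OF f, of j] forms_power[OF l(1), of "h - j"]] that
      by (simp add: h_def)
    from t[OF this] obtain g where
      g: "g \<in> forms t" "(h, \<lambda>x. f x ^ j * l x ^ (h - j) - l x ^ s * g x) \<in> M"
      by (auto simp: h_def)
    from forms_word_expansion[OF g(1)] obtain e where
      "g = (\<lambda>x. \<Sum>ws\<in>W. e ws * (\<Prod>i\<leftarrow>ws. x $ i))" unfolding W_def by (elim exE)
    with g(2) have "R j e" by (simp add: R_def)
    then show ?thesis by (rule exI[of "R j"])
  qed
  then obtain e where "\<And>j. j \<le> h \<Longrightarrow> R j (e j)" by metis
  then have e: "\<And>j. j \<le> h \<Longrightarrow>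
      (h, \<lambda>x. f x ^ j * l x ^ (h - j) - l x ^ s * (\<Sum>ws\<in>W. e j ws * (\<Prod>i\<leftarrow>ws. x $ i))) \<in> M"
    unfolding R_def .
  have "finite W" using finite_words by (simp add: W_def)
  then obtain c where c: "\<exists>j\<in>{..h}. c j \<noteq> 0" "\<forall>ws\<in>W. (\<Sum>j\<in>{..h}. c j * e j ws) = 0"
    using linear_system_nontrivial[of W "{..h}" e] by (auto simp: h_def s_def)
  define p where "p = (\<Sum>j\<le>h. monom (c j) j)"
  have coeff: "coeff p j = (if j \<le> h then c j else 0)" for j
    by (simp add: p_def coeff_sum)
  have "(h, \<lambda>x. \<Sum>j\<le>h. c j * (f x ^ j * l x ^ (h - j) - l x ^ s * (\<Sum>ws\<in>W. e j ws * (\<Prod>i\<leftarrow>ws. x $ i)))) \<in> M"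
    by (intro ideal_sum[OF M] ideal_cmult[OF M] e) auto
  also have "(\<lambda>x. \<Sum>j\<le>h. c j * (f x ^ j * l x ^ (h - j) - l x ^ s * (\<Sum>ws\<in>W. e j ws * (\<Prod>i\<leftarrow>ws. x $ i))))
      = (\<lambda>x. binary_form p h (f x) (l x))"
  proof
    fix x
    have "(\<Sum>j\<le>h. c j * (l x ^ s * (\<Sum>ws\<in>W. e j ws * (\<Prod>i\<leftarrow>ws. x $ i))))
        = l x ^ s * (\<Sum>j\<le>h. \<Sum>ws\<in>W. (c j * e j ws) * (\<Prod>i\<leftarrow>ws. x $ i))"
      by (simp add: sum_distrib_left mult_ac)
    also have "\<dots> = l x ^ s * (\<Sum>ws\<in>W. (\<Sum>j\<le>h. c j * e j ws) * (\<Prod>i\<leftarrow>ws. x $ i))"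
      by (subst sum.swap) (simp add: sum_distrib_right)
    also have "\<dots> = 0" using c(2) by simp
    finally show "(\<Sum>j\<le>h. c j * (f x ^ j * l x ^ (h - j) - l x ^ s * (\<Sum>ws\<in>W. e j ws * (\<Prod>i\<leftarrow>ws. x $ i))))
      = binary_form p h (f x) (l x)"
      by (simp add: right_diff_distrib sum_subtractf binary_form_def coeff)
  qed
  finally have "(h, \<lambda>x. binary_form p h (f x) (l x)) \<in> M" .
  moreover have "p \<noteq> 0" using c(1) coeff by (metis atMost_iff coeff_0)
  moreover have "degree p \<le> h" by (rule degree_le) (simp add: coeff)
  ultimately show ?thesis using binary_form_factor_in_maximal[OF f l] by blast
qed

text \<open>
  Every coordinate is a multiple \<open>a\<^sub>i l\<close> of one coordinate \<open>l\<close> modulo \<open>M\<close>. Hence a form \<open>f\<close> of degree \<open>t\<close> is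
  congruent to \<open>f(a) l\<^sup>t\<close>, and \<open>f(a) = 0\<close> if \<open>f\<close> is in \<open>M\<close>.
\<close>

lemma maximal_relevant_zero:
  "\<exists>c. c \<noteq> 0 \<and> (\<forall>t f. (t, f) \<in> M \<longrightarrow> f c = 0)"
proof -
  obtain k where k: "(1, \<lambda>x. x $ k) \<notin> M" using coordinate_notin_maximal by blast
  define l where "l = (\<lambda>x :: complex ^ 'n. x $ k)"
  have l: "l \<in> forms 1" "(1, l) \<notin> M" using k forms_coord[of k] by (auto simp: l_def)
  have "\<forall>i. \<exists>a. (1, \<lambda>x. x $ i - a * l x) \<in> M"
    using linear_forms_proportional_mod_maximal[OF forms_coord l] by (rule allI)
  from choice[OF this] obtain a where a: "\<And>i. (1, \<lambda>x. x $ i - a i * l x) \<in> M" by (elim exE) blast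
  define c where "c = (\<chi> i. a i)"
  have "a k = 1"
  proof (rule ccontr)
    assume "a k \<noteq> 1"
    then have "1 / (1 - a k) * (x $ k - a k * l x) = l x" for x
      by (simp add: l_def field_simps)
    with ideal_cmult[OF M a[of k], of "1 / (1 - a k)"] have "(1, \<lambda>x. l x) \<in> M"
      by (simp only: )
    with l(2) show False by simp
  qed
  then have "c $ k \<noteq> 0" by (simp add: c_def)
  then have "c \<noteq> 0" by auto
  have congr: "(t, \<lambda>x. f x - f c * l x ^ t) \<in> M" if "f \<in> forms t" for f t
    using that
  proof (induction t arbitrary: f)
    case 0
    then show ?case using ideal_zero[OF M] by (auto elim!: forms_0E)
  next
    case (Suc t)
    then obtain g where g: "\<And>i. g i \<in> forms t" "f = (\<lambda>x. \<Sum>i\<in>UNIV. x $ i * g i x)"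
      by (auto simp: forms.simps)
    have "(Suc t, \<lambda>x. x $ i * g i x - c $ i * g i c * l x ^ Suc t) \<in> M" for i
    proof -
      have "(Suc t, \<lambda>x. (x $ i - a i * l x) * g i x) \<in> M"
        using ideal_mult[OF M a[of i] g(1)[of i]] by simp
      moreover have "(Suc t, \<lambda>x. (g i x - g i c * l x ^ t) * (a i * l x)) \<in> M"
        using ideal_mult[OF M Suc.IH[OF g(1)[of i]] forms_cmult[OF l(1), of "a i"]] by simp
      ultimately have "(Suc t, \<lambda>x. (x $ i - a i * l x) * g i x
          + (g i x - g i c * l x ^ t) * (a i * l x)) \<in> M"
        by (rule ideal_add[OF M])
      then show ?thesis by (simp add: c_def algebra_simps)
    qed
    then have "(Suc t, \<lambda>x. \<Sum>i\<in>UNIV. x $ i * g i x - c $ i * g i c * l x ^ Suc t) \<in> M"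
      by (rule ideal_sum[OF M])
    then show ?case
      by (simp add: g(2) sum_subtractf sum_distrib_right)
  qed
  have "f c = 0" if f: "(t, f) \<in> M" for t f
  proof (rule ccontr)
    assume fc: "f c \<noteq> 0"
    have "(t, \<lambda>x. f x + (-1) * (f x - f c * l x ^ t)) \<in> M"
      using ideal_add[OF M f ideal_cmult[OF M congr[OF ideal_forms[OF M f]]]] .
    from ideal_cmult[OF M this, of "1 / f c"] fc have "(t, \<lambda>x. l x ^ t) \<in> M" by simp
    with power_notin_maximal[OF l] show False by blast
  qed
  with \<open>c \<noteq> 0\<close> show ?thesis by blast
qed

end

theorem projective_nullstellensatz:
  assumes P: "graded_ideal P" and nz: "\<And>c. c \<noteq> 0 \<Longrightarrow> \<exists>t f. (t, f) \<in> P \<and> f c \<noteq> 0"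
  shows "\<exists>t. contains_degree P t"
proof (rule ccontr)
  assume "\<not> ?thesis"
  with maximal_relevant_exists[OF P] obtain M where
    M: "graded_ideal M" "P \<subseteq> M" "\<And>t. \<not> contains_degree M t"
      "\<And>Q. graded_ideal Q \<Longrightarrow> M \<subseteq> Q \<Longrightarrow> (\<And>t. \<not> contains_degree Q t) \<Longrightarrow> Q = M" by blast
  from maximal_relevant_zero[OF M(1,3,4)] obtain c where "c \<noteq> 0" "\<And>t f. (t, f) \<in> M \<Longrightarrow> f c = 0"
    by blast
  with nz M(2) show False by blast
qed


section \<open>Perturbing a matrix of given rank to an invertible one\<close>

lemma spanning_rows_det:
  fixes N :: "complex ^ 'n::finite ^ 'n"
  shows "det N \<noteq> 0 \<longleftrightarrow> vec.span (rows N) = UNIV"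
  using matrix_left_invertible_span_rows_gen[of N] invertible_det_nz[of N] invertible_left_inverse[of N]
  by simp

lemma rows_image: "rows N = range (\<lambda>i. row i N)"
  by (auto simp: rows_def)

text \<open>
  Keep a maximal independent set \<open>J\<close> of rows of \<open>A\<close>, and replace the other rows so that a basis
  arises; \<open>C\<close> is the change.
\<close>

lemma rank_completion:
  fixes A :: "complex ^ 'n::finite ^ 'n"
  obtains J C where "card J = rank A" "\<And>i. i \<in> J \<Longrightarrow> C $ i = 0" "det (A + C) \<noteq> 0"
proof -
  obtain B where B: "B \<subseteq> rows A" "vec.independent B" "rows A \<subseteq> vec.span B" "card B = vec.dim (rows A)"
    by (rule vec.basis_exists[of "rows A"])
  obtain B' where B': "B \<subseteq> B'" "vec.independent B'" "UNIV \<subseteq> vec.span B'"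
    by (rule vec.maximal_independent_subset_extend[OF subset_UNIV B(2)])
  have fin: "finite B'" "finite B" using B' B vec.finiteI_independent by blast+
  have cB': "card B' = CARD('n)"
    using vec.basis_card_eq_dim[OF subset_UNIV B'(3,2)] by (simp only: vec_dim_card)
  have "\<forall>b\<in>B. \<exists>i. row i A = b" using B(1) by (auto simp: rows_image)
  then obtain idx where idx: "\<And>b. b \<in> B \<Longrightarrow> row (idx b) A = b" by metis
  then have inj: "inj_on idx B" by (metis inj_onI)
  define J where "J = idx ` B"
  have cJ: "card J = card B" using inj by (simp add: J_def card_image)
  have "card (UNIV - J) = card (B' - B)"
    using cJ cB' B'(1) fin by (simp add: card_Diff_subset)
  then obtain \<phi> where \<phi>: "bij_betw \<phi> (UNIV - J) (B' - B)"
    using fin by (metis finite_same_card_bij finite_Diff finite)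
  define C where "C = (\<chi> i. if i \<in> J then 0 else \<phi> i - A $ i)"
  have AC: "(A + C) $ i = (if i \<in> J then A $ i else \<phi> i)" for i
    by (simp add: C_def)
  have row: "row i N = N $ i" for i and N :: "complex ^ 'n ^ 'n"
    by (simp add: row_def vec_eq_iff)
  have "B' \<subseteq> rows (A + C)"
  proof
    fix b assume b: "b \<in> B'"
    show "b \<in> rows (A + C)"
    proof (cases "b \<in> B")
      case True
      then have "(A + C) $ idx b = b" using idx[OF True] by (subst AC) (simp add: J_def row)
      then show ?thesis unfolding rows_image row by (metis rangeI)
    next
      case False
      with b have "b \<in> \<phi> ` (UNIV - J)" using \<phi> by (simp add: bij_betw_def)
      then obtain i where "i \<notin> J" "\<phi> i = b" by auto
      then have "(A + C) $ i = b" by (subst AC) simp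
      then show ?thesis unfolding rows_image row by (metis rangeI)
    qed
  qed
  then have "vec.span (rows (A + C)) = UNIV"
    using B'(3) vec.span_mono by blast
  then have "det (A + C) \<noteq> 0" by (simp only: spanning_rows_det)
  moreover have "card J = rank A" by (simp add: cJ B(4) row_rank_def_gen)
  moreover have "C $ i = 0" if "i \<in> J" for i using that by (simp add: C_def)
  ultimately show ?thesis using that by blast
qed

text \<open>
  The rows in \<open>J\<close> are independent, being rows of an invertible matrix, so they span all rows of \<open>A\<close>.
\<close>

lemma kernel_from_independent_rows:
  fixes A C :: "complex ^ 'n::finite ^ 'n"
  assumes J: "card J = rank A" and C: "\<And>i. i \<in> J \<Longrightarrow> C $ i = 0" and det: "det (A + C) \<noteq> 0"
    and u: "\<And>i. i \<in> J \<Longrightarrow> (A *v u) $ i = 0"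
  shows "A *v u = 0"
proof -
  let ?M = "A + C"
  have row: "row i N = N $ i" for i and N :: "complex ^ 'n ^ 'n"
    by (simp add: row_def vec_eq_iff)
  have sp: "vec.span (rows ?M) = UNIV" using det by (simp only: spanning_rows_det)
  have fin: "finite (rows ?M)" by (simp add: rows_image)
  have le: "card (rows ?M) \<le> CARD('n)" unfolding rows_image by (rule card_image_le) simp
  have dim: "vec.dim (UNIV :: (complex ^ 'n) set) = CARD('n)" by (rule vec_dim_card)
  have ind: "vec.independent (rows ?M)"
    using vec.card_le_dim_spanning[of "rows ?M" UNIV] sp fin le dim by simp
  have "CARD('n) \<le> card (rows ?M)"
    using vec.dim_le_card[of UNIV "rows ?M"] sp fin dim by simp
  with le have "card (range (\<lambda>i. row i ?M)) = CARD('n)" by (simp add: rows_image)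
  then have inj: "inj (\<lambda>i. row i ?M)" by (simp add: eq_card_imp_inj_on)
  define B where "B = (\<lambda>i. row i ?M) ` J"
  have BA: "B = (\<lambda>i. A $ i) ` J" unfolding B_def row using C by (auto intro!: image_cong)
  have "vec.independent B"
    by (rule vec.independent_mono[OF ind]) (auto simp: B_def rows_image)
  moreover have "card B = card J"
    unfolding B_def by (rule card_image) (use inj in \<open>auto simp: inj_on_def\<close>)
  moreover have "B \<subseteq> rows A" by (auto simp: BA rows_image row)
  ultimately have span: "rows A \<subseteq> vec.span B"
    using J by (intro vec.card_ge_dim_independent) (auto simp: row_rank_def_gen)
  have "A $ i \<in> vec.span B" for i using span by (auto simp: rows_image row)
  moreover have "vec.subspace {a :: complex ^ 'n. (\<Sum>k\<in>UNIV. a $ k * u $ k) = 0}"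
    by (simp add: vec.subspace_def algebra_simps sum.distrib flip: sum_distrib_left)
  moreover have "B \<subseteq> {a. (\<Sum>k\<in>UNIV. a $ k * u $ k) = 0}"
    using u by (auto simp: BA matrix_vector_mult_def)
  ultimately have "(\<Sum>k\<in>UNIV. A $ i $ k * u $ k) = 0" for i
    using vec.span_minimal by blast
  then show ?thesis by (simp add: vec_eq_iff matrix_vector_mult_def)
qed

definition cofactor :: "complex ^ 'n::finite ^ 'n \<Rightarrow> 'n \<Rightarrow> 'n \<Rightarrow> complex" where
  "cofactor M m k = det (\<chi> j. if j = k then axis m 1 else column j M)"

lemma cramer_cofactor:
  fixes M :: "complex ^ 'n::finite ^ 'n"
  shows "y $ k * det M = (\<Sum>m\<in>UNIV. (M *v y) $ m * cofactor M m k)"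
proof -
  have row: "row i (transpose M) = column i M" for i by simp
  have exp: "(\<Sum>i\<in>UNIV. y $ i *s column i M) = (\<Sum>m\<in>UNIV. (M *v y) $ m *s axis m 1)"
    unfolding matrix_mult_sum[symmetric] by (rule basis_expansion[symmetric])
  have "y $ k * det M = y $ k * det (transpose M)" by simp
  also have "\<dots> = det (\<chi> i. if i = k then \<Sum>m\<in>UNIV. (M *v y) $ m *s axis m 1 else column i M)"
    unfolding cramer_lemma_transpose[symmetric] row exp ..
  also have "\<dots> = (\<Sum>m\<in>UNIV. det (\<chi> i. if i = k then (M *v y) $ m *s axis m 1 else column i M))"
    by (rule det_linear_row_sum) simp
  also have "\<dots> = (\<Sum>m\<in>UNIV. (M *v y) $ m * cofactor M m k)"
    by (simp add: det_row_mul cofactor_def)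
  finally show ?thesis .
qed

lemma symmetric_matrix_swap:
  fixes A :: "complex ^ 'n::finite ^ 'n"
  assumes "transpose A = A"
  shows "(\<Sum>k\<in>UNIV. (A *v w) $ k * y $ k) = (\<Sum>k\<in>UNIV. w $ k * (A *v y) $ k)"
proof -
  have sym: "A $ i $ j = A $ j $ i" for i j
    using assms by (metis transpose_def vec_lambda_beta)
  have "(\<Sum>k\<in>UNIV. (A *v w) $ k * y $ k) = (\<Sum>k\<in>UNIV. \<Sum>j\<in>UNIV. A $ k $ j * w $ j * y $ k)"
    by (simp add: matrix_vector_mult_def sum_distrib_right)
  also have "\<dots> = (\<Sum>j\<in>UNIV. \<Sum>k\<in>UNIV. w $ j * (A $ j $ k * y $ k))"
    by (subst sum.swap) (simp add: sym mult_ac)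
  also have "\<dots> = (\<Sum>k\<in>UNIV. w $ k * (A *v y) $ k)"
    by (simp add: matrix_vector_mult_def sum_distrib_left)
  finally show ?thesis .
qed

text \<open>
  The vector \<open>y = (A + C)\<^sup>-\<^sup>1 A w\<close> satisfies \<open>A y = A w\<close>: both sides agree in the rows \<open>J\<close>, where \<open>C\<close>
  vanishes. Hence \<open>w\<^sup>T A w = (A w)\<^sup>T y\<close>, and Cramer's rule expresses \<open>y\<close> in terms of \<open>A w\<close>.
\<close>

lemma quadratic_form_via_cofactors:
  fixes A C :: "complex ^ 'n::finite ^ 'n"
  assumes sym: "transpose A = A" and J: "card J = rank A" and C: "\<And>i. i \<in> J \<Longrightarrow> C $ i = 0"
    and det: "det (A + C) \<noteq> 0"
  shows "(\<Sum>k\<in>UNIV. w $ k * (A *v w) $ k) * det (A + C) =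
     (\<Sum>k\<in>UNIV. \<Sum>m\<in>UNIV. (A *v w) $ k * (A *v w) $ m * cofactor (A + C) m k)"
proof -
  let ?M = "A + C"
  have "surj ((*v) ?M)"
    using det invertible_det_nz[of ?M] by (simp add: invertible_eq_bij bij_is_surj)
  then obtain y where y: "?M *v y = A *v w" by (metis surjE)
  have "A *v (y - w) = 0"
  proof (rule kernel_from_independent_rows[OF J C det])
    fix i assume "i \<in> J"
    then have "(C *v y) $ i = 0" using C by (simp add: matrix_vector_mult_def)
    moreover have "(A *v y) $ i + (C *v y) $ i = (A *v w) $ i"
      unfolding y[symmetric] by (simp add: matrix_vector_mult_add_rdistrib)
    ultimately show "(A *v (y - w)) $ i = 0"
      by (simp add: matrix_vector_mult_diff_distrib)
  qed
  then have Ay: "A *v y = A *v w" by (simp add: matrix_vector_mult_diff_distrib)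
  have "(\<Sum>k\<in>UNIV. w $ k * (A *v w) $ k) = (\<Sum>k\<in>UNIV. (A *v w) $ k * y $ k)"
    using symmetric_matrix_swap[OF sym, of w y] Ay by simp
  then show ?thesis
    by (simp add: sum_distrib_right sum_distrib_left mult.assoc cramer_cofactor y)
qed

text \<open>By polarization, a symmetric matrix with zero quadratic form has zero bilinear form.\<close>

lemma symmetric_form_nonzero:
  fixes A :: "complex ^ 'n::finite ^ 'n"
  assumes sym: "transpose A = A" and A: "A \<noteq> 0"
  shows "\<exists>w. (\<Sum>k\<in>UNIV. w $ k * (A *v w) $ k) \<noteq> 0"
proof (rule ccontr)
  assume "\<not> ?thesis"
  then have z: "(\<Sum>k\<in>UNIV. w $ k * (A *v w) $ k) = 0" for w by blast
  have bil: "(\<Sum>k\<in>UNIV. w $ k * (A *v y) $ k) = 0" for w y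
  proof -
    have "0 = (\<Sum>k\<in>UNIV. (w + y) $ k * (A *v (w + y)) $ k)" using z[of "w + y"] by (rule HOL.sym)
    also have "\<dots> = (\<Sum>k\<in>UNIV. w $ k * (A *v w) $ k) + (\<Sum>k\<in>UNIV. y $ k * (A *v y) $ k)
       + (\<Sum>k\<in>UNIV. w $ k * (A *v y) $ k) + (\<Sum>k\<in>UNIV. y $ k * (A *v w) $ k)"
      by (simp add: matrix_vector_right_distrib algebra_simps sum.distrib)
    also have "(\<Sum>k\<in>UNIV. y $ k * (A *v w) $ k) = (\<Sum>k\<in>UNIV. w $ k * (A *v y) $ k)"
      using symmetric_matrix_swap[OF sym, of w y] by (simp add: mult.commute)
    finally show ?thesis using z by simp
  qed
  have "A $ i $ j = 0" for i j
  proof -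
    have "(\<Sum>k\<in>UNIV. (axis i 1 :: complex ^ 'n) $ k * (A *v axis j 1) $ k) = (A *v axis j 1) $ i"
      by (simp add: axis_def if_distrib[of "\<lambda>z. z * _"] cong: if_cong)
    also have "\<dots> = A $ i $ j"
      by (simp add: matrix_vector_mult_def axis_def if_distrib[of "\<lambda>z. _ * z"] cong: if_cong)
    finally show ?thesis using bil by simp
  qed
  with A show False by (simp add: vec_eq_iff)
qed


section \<open>Growth of the number of independent forms\<close>

text \<open>
  Irreducibility of a cone, expressed through the forms vanishing on it; the cone \<open>{0}\<close> over the empty
  set is excluded.
\<close>

definition prime_cone :: "(complex ^ 'n::finite) set \<Rightarrow> bool" where
  "prime_cone Z \<longleftrightarrow> (\<exists>v\<in>Z. v \<noteq> 0) \<and>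
     (\<forall>a b. \<forall>f\<in>forms a. \<forall>g\<in>forms b. (\<forall>x\<in>Z. f x * g x = 0) \<longrightarrow>
        (\<forall>x\<in>Z. f x = 0) \<or> (\<forall>x\<in>Z. g x = 0))"

lemma prime_coneD:
  assumes "prime_cone Z" "f \<in> forms a" "g \<in> forms b" "\<And>x. x \<in> Z \<Longrightarrow> f x * g x = 0"
    "z \<in> Z" "f z \<noteq> 0" "x \<in> Z"
  shows "g x = 0"
  using assms unfolding prime_cone_def by blast

definition independent_family ::
    "(complex ^ 'n::finite) set \<Rightarrow> nat \<Rightarrow> nat \<Rightarrow> (nat \<Rightarrow> complex ^ 'n \<Rightarrow> complex) \<Rightarrow> bool" where
  "independent_family Z t m b \<longleftrightarrow> (\<forall>i<m. b i \<in> forms t) \<and>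
     (\<forall>c. (\<forall>x\<in>Z. (\<Sum>i<m. c i * b i x) = 0) \<longrightarrow> (\<forall>i<m. c i = 0))"

definition independent_forms :: "(complex ^ 'n::finite) set \<Rightarrow> nat \<Rightarrow> nat \<Rightarrow> bool" where
  "independent_forms Z t m \<longleftrightarrow> (\<exists>b. independent_family Z t m b)"

lemma independent_familyI:
  assumes "\<And>i. i < m \<Longrightarrow> b i \<in> forms t"
    and "\<And>c i. (\<And>x. x \<in> Z \<Longrightarrow> (\<Sum>i<m. c i * b i x) = 0) \<Longrightarrow> i < m \<Longrightarrow> c i = 0"
  shows "independent_family Z t m b"
  unfolding independent_family_def
proof (intro conjI allI impI)
  fix c i assume "\<forall>x\<in>Z. (\<Sum>i<m. c i * b i x) = 0" "i < m"
  then show "c i = 0" using assms(2)[of c i] by simp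
qed (rule assms(1))

lemma independent_family_forms: "independent_family Z t m b \<Longrightarrow> i < m \<Longrightarrow> b i \<in> forms t"
  by (simp add: independent_family_def)

lemma independent_familyD:
  "independent_family Z t m b \<Longrightarrow> (\<And>x. x \<in> Z \<Longrightarrow> (\<Sum>i<m. c i * b i x) = 0) \<Longrightarrow> i < m \<Longrightarrow> c i = 0"
  by (simp add: independent_family_def)

lemma independent_forms_superset:
  assumes "independent_forms Z t m" "Z \<subseteq> Z'" shows "independent_forms Z' t m"
proof -
  from assms(1) obtain b where b: "independent_family Z t m b"
    by (auto simp: independent_forms_def)
  have "independent_family Z' t m b"
  proof (rule independent_familyI)
    fix c i assume "\<And>x. x \<in> Z' \<Longrightarrow> (\<Sum>i<m. c i * b i x) = 0" "i < m"
    with assms(2) independent_familyD[OF b, of c i] show "c i = 0" by (simp add: subset_iff)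
  qed (rule independent_family_forms[OF b])
  then show ?thesis by (auto simp: independent_forms_def)
qed

lemma independent_forms_one:
  assumes "v \<in> Z" "v \<noteq> 0" shows "independent_forms Z t 1"
proof -
  from assms(2) obtain i where i: "v $ i \<noteq> 0" by (auto simp: vec_eq_iff)
  have "(\<lambda>x. (x $ i) ^ t) \<in> forms t" using forms_power[OF forms_coord[of i], of t] by simp
  have "independent_family Z t 1 (\<lambda>_ x. (x $ i) ^ t)"
  proof (rule independent_familyI)
    show "(\<lambda>x. (x $ i) ^ t) \<in> forms t" by fact
  next
    fix c :: "nat \<Rightarrow> complex" and j :: nat
    assume "\<And>x. x \<in> Z \<Longrightarrow> (\<Sum>j<1. c j * (x $ i) ^ t) = 0" "j < 1"
    from this(1)[OF assms(1)] this(2) i show "c j = 0" by simp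
  qed
  then show ?thesis by (auto simp: independent_forms_def)
qed

lemma sum_lessThan_add:
  fixes g :: "nat \<Rightarrow> 'a::comm_monoid_add"
  shows "(\<Sum>i<m + k. g i) = (\<Sum>i<m. g i) + (\<Sum>i<k. g (m + i))"
  by (induction k) (auto simp: add.assoc)

text \<open>
  The multiples of \<open>f\<close> vanish on \<open>Z\<close> and there are as many of them as forms of degree \<open>t\<close> on \<open>Z'\<close>;
  forms independent on \<open>Z\<close> are independent modulo these.
\<close>

lemma independent_forms_step:
  assumes Z': "prime_cone Z'" and f: "f \<in> forms a" "\<And>x. x \<in> Z \<Longrightarrow> f x = 0" "z \<in> Z'" "f z \<noteq> 0"
    and sub: "Z \<subseteq> Z'" and ind: "independent_forms Z (t + a) m" "independent_forms Z' t k"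
  shows "independent_forms Z' (t + a) (m + k)"
proof -
  from ind obtain b b' where b: "independent_family Z (t + a) m b" and b': "independent_family Z' t k b'"
    by (auto simp: independent_forms_def)
  define d where "d i = (if i < m then b i else (\<lambda>x. b' (i - m) x * f x))" for i
  have "d i \<in> forms (t + a)" if "i < m + k" for i
    unfolding d_def using that independent_family_forms[OF b, of i]
      forms_mult[OF independent_family_forms[OF b', of "i - m"] f(1)] by auto
  moreover have "c i = 0" if c: "\<And>x. x \<in> Z' \<Longrightarrow> (\<Sum>i<m + k. c i * d i x) = 0" and "i < m + k" for c i
  proof -
    have split: "(\<Sum>i<m + k. c i * d i x) = (\<Sum>i<m. c i * b i x) + (\<Sum>i<k. c (m + i) * b' i x) * f x" for x
      by (simp add: sum_lessThan_add d_def sum_distrib_right mult.assoc)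
    have low: "c i = 0" if "i < m" for i
    proof (rule independent_familyD[OF b _ that])
      fix x assume x: "x \<in> Z"
      then have "(\<Sum>i<m + k. c i * d i x) = 0" using sub c by blast
      then show "(\<Sum>i<m. c i * b i x) = 0" unfolding split by (simp add: f(2)[OF x])
    qed
    have "(\<lambda>x. \<Sum>i<k. c (m + i) * b' i x) \<in> forms t"
      by (rule forms_lincomb) (use independent_family_forms[OF b'] in auto)
    then have "(\<Sum>i<k. c (m + i) * b' i x) = 0" if "x \<in> Z'" for x
    proof (rule prime_coneD[OF Z' f(1) _ _ f(3,4) that])
      fix y assume "y \<in> Z'"
      from c[OF this] show "f y * (\<Sum>i<k. c (m + i) * b' i y) = 0"
        unfolding split by (simp add: mult.commute low)
    qed
    then have high: "c (m + i) = 0" if "i < k" for i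
      using independent_familyD[OF b', of "\<lambda>i. c (m + i)" i] that by blast
    show ?thesis
      using low high[of "i - m"] that(2) by (cases "i < m") auto
  qed
  ultimately have "independent_family Z' (t + a) (m + k) d" by (rule independent_familyI)
  then show ?thesis by (auto simp: independent_forms_def)
qed

text \<open>
  A lower bound for the Hilbert function. Summing the inequality of \<open>independent_forms_step\<close> over about
  \<open>t / 2a\<close> steps of size \<open>a\<close>, in degrees at least \<open>t / 2\<close>, raises the exponent by one for each strict
  inclusion of the chain.
\<close>

lemma independent_forms_growth:
  fixes Z :: "nat \<Rightarrow> (complex ^ 'n::finite) set"
  assumes "\<And>i. i \<le> D \<Longrightarrow> prime_cone (Z i)" "\<And>i. i < D \<Longrightarrow> Z i \<subseteq> Z (Suc i)"
    and "\<And>i. i < D \<Longrightarrow> \<exists>a. \<exists>f\<in>forms a. (\<forall>x\<in>Z i. f x = 0) \<and> (\<exists>x\<in>Z (Suc i). f x \<noteq> 0)"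
  shows "\<exists>c>0. \<forall>t. \<exists>m. independent_forms (Z D) t m \<and> c * real t ^ D \<le> real m"
  using assms
proof (induction D)
  case 0
  then obtain v where "v \<in> Z 0" "v \<noteq> 0" by (auto simp: prime_cone_def)
  from independent_forms_one[OF this] have "\<forall>t. independent_forms (Z 0) t 1" by blast
  then show ?case by (intro exI[of _ 1]) auto
next
  case (Suc D)
  have "\<exists>c>0. \<forall>t. \<exists>m. independent_forms (Z D) t m \<and> c * real t ^ D \<le> real m"
    by (rule Suc.IH) (use Suc.prems in auto)
  then obtain c where c: "c > 0"
    "\<And>t. \<exists>m. independent_forms (Z D) t m \<and> c * real t ^ D \<le> real m" by blast
  from Suc.prems(3)[of D] obtain a f z where
    f: "f \<in> forms a" "\<And>x. x \<in> Z D \<Longrightarrow> f x = 0" "z \<in> Z (Suc D)" "f z \<noteq> 0" by blast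
  have sub: "Z D \<subseteq> Z (Suc D)" using Suc.prems(2) by simp
  have Z': "prime_cone (Z (Suc D))" using Suc.prems(1) by simp
  from Suc.prems(1)[of D] obtain v where "v \<in> Z D" by (auto simp: prime_cone_def)
  have a: "a > 0"
  proof (rule ccontr)
    assume "\<not> a > 0"
    with f(1) obtain b where "f = (\<lambda>x. b)" by (auto elim: forms_0E)
    with f(2)[OF \<open>v \<in> Z D\<close>] f(4) show False by simp
  qed
  have steps: "\<exists>m. independent_forms (Z (Suc D)) (s + q * a) m \<and> real (q + 1) * (c * real s ^ D) \<le> real m"
    for s q
  proof (induction q)
    case 0
    from c(2)[of s] independent_forms_superset[OF _ sub] show ?case by auto
  next
    case (Suc q)
    then obtain k where k: "independent_forms (Z (Suc D)) (s + q * a) k"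
      "real (q + 1) * (c * real s ^ D) \<le> real k" by blast
    from c(2)[of "s + q * a + a"] obtain m where m: "independent_forms (Z D) (s + q * a + a) m"
      "c * real (s + q * a + a) ^ D \<le> real m" by blast
    have "c * real s ^ D \<le> c * real (s + q * a + a) ^ D"
      using c(1) by (intro mult_left_mono power_mono) auto
    with m(2) k(2) have "real (Suc q + 1) * (c * real s ^ D) \<le> real (m + k)"
      by (simp add: algebra_simps)
    moreover have "independent_forms (Z (Suc D)) (s + Suc q * a) (m + k)"
      using independent_forms_step[OF Z' f sub m(1) k(1)] by (simp add: algebra_simps)
    ultimately show ?case by blast
  qed
  define c' where "c' = c / (2 ^ D * (2 * real a))"
  have "\<exists>m. independent_forms (Z (Suc D)) t m \<and> c' * real t ^ Suc D \<le> real m" for t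
  proof -
    \<comment> \<open>\<open>q\<close> steps of size \<open>a\<close> from \<open>s\<close> to \<open>t\<close>; the choice of \<open>q\<close> keeps all degrees at least \<open>t / 2\<close>\<close>
    define q where "q = t div (2 * a)"
    define s where "s = t - q * a"
    have "2 * a * q \<le> t" unfolding q_def by (rule times_div_less_eq_dividend)
    then have qa: "2 * (q * a) \<le> t" by (simp add: mult_ac)
    then have t: "t = s + q * a" unfolding s_def by simp
    with qa have "t \<le> 2 * s" by (simp add: mult.commute)
    then have "real t \<le> real (2 * s)" by (simp only: of_nat_le_iff)
    then have s: "real t / 2 \<le> real s" by simp
    have "t < 2 * a * (q + 1)" unfolding q_def using a
      by (metis Suc_eq_plus1 dividend_less_times_div mult_Suc_right nat_0_less_mult_iff zero_less_numeral add.commute)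
    then have "real t < real (2 * a * (q + 1))" by (simp only: of_nat_less_iff)
    then have q: "real t / (2 * real a) \<le> real (q + 1)"
      using a by (simp add: field_simps)
    obtain m where m: "independent_forms (Z (Suc D)) (s + q * a) m"
      "real (q + 1) * (c * real s ^ D) \<le> real m" using steps by blast
    have "c' * real t ^ Suc D = real t / (2 * real a) * (c * (real t / 2) ^ D)"
      by (simp add: c'_def power_divide mult_ac)
    also have "\<dots> \<le> real (q + 1) * (c * real s ^ D)"
      using q s c(1) by (intro mult_mono power_mono) auto
    finally show ?thesis using m t by auto
  qed
  moreover have "c' > 0" using c(1) a by (simp add: c'_def)
  ultimately show ?case by blast
qed

lemma power_growth_contradiction:
  fixes c K :: real
  assumes c: "c > 0" and D: "D > n" and bound: "\<And>a :: nat. a \<ge> 1 \<Longrightarrow> c * real a ^ D \<le> K * real a ^ n"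
  shows False
proof -
  obtain a :: nat where a: "real a > max 1 (K / c)" using reals_Archimedean2 by blast
  then have a1: "a \<ge> 1" "real a \<ge> 1" by auto
  have "c * real a * real a ^ n = c * real a ^ Suc n" by simp
  also have "\<dots> \<le> c * real a ^ D"
    using a1 c D by (intro mult_left_mono power_increasing) auto
  also have "\<dots> \<le> K * real a ^ n" using bound a1 by blast
  finally have "c * real a \<le> K" using a1 by simp
  with a c show False by (simp add: field_simps)
qed


section \<open>Spans of monomials in given functions\<close>

definition exponent_box :: "nat \<Rightarrow> ('n::finite \<Rightarrow> nat) set" where
  "exponent_box m = {\<alpha>. \<forall>i. \<alpha> i \<le> m}"

lemma exponent_box_PiE: "exponent_box m = PiE UNIV (\<lambda>_. {..m})"
  by (auto simp: exponent_box_def PiE_def Pi_def)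

lemma finite_exponent_box: "finite (exponent_box m :: ('n::finite \<Rightarrow> nat) set)"
  by (simp add: exponent_box_PiE finite_PiE)

lemma card_exponent_box: "card (exponent_box m :: ('n::finite \<Rightarrow> nat) set) = (m + 1) ^ CARD('n)"
  by (simp add: exponent_box_PiE card_PiE)

text \<open>
  Only the values on \<open>Y\<close> matter. Bounding each exponent by \<open>m\<close>, instead of the degree, makes the
  number of generators a power.
\<close>

definition monomial_span ::
    "'y set \<Rightarrow> ('n::finite \<Rightarrow> 'y \<Rightarrow> complex) \<Rightarrow> 's set \<Rightarrow> ('s \<Rightarrow> 'y \<Rightarrow> complex) \<Rightarrow> nat \<Rightarrow> ('y \<Rightarrow> complex) set" where
  "monomial_span Y lam S e m = {\<phi>. \<exists>c. \<forall>y\<in>Y. \<phi> y =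
     (\<Sum>\<alpha>\<in>exponent_box m. \<Sum>s\<in>S. c \<alpha> s * ((\<Prod>i\<in>UNIV. lam i y ^ \<alpha> i) * e s y))}"

context
  fixes Y :: "'y set" and lam :: "'n::finite \<Rightarrow> 'y \<Rightarrow> complex" and S :: "'s set"
    and e :: "'s \<Rightarrow> 'y \<Rightarrow> complex"
  assumes S: "finite S"
begin

lemma monomial_span_cong:
  assumes "\<phi> \<in> monomial_span Y lam S e m" "\<And>y. y \<in> Y \<Longrightarrow> \<psi> y = \<phi> y"
  shows "\<psi> \<in> monomial_span Y lam S e m"
  using assms by (simp add: monomial_span_def)

lemma monomial_span_zero: "(\<lambda>y. 0) \<in> monomial_span Y lam S e m"
  by (auto simp: monomial_span_def intro!: exI[of _ "\<lambda>_ _. 0"])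

lemma monomial_span_add:
  assumes "\<phi> \<in> monomial_span Y lam S e m" "\<psi> \<in> monomial_span Y lam S e m"
  shows "(\<lambda>y. \<phi> y + \<psi> y) \<in> monomial_span Y lam S e m"
proof -
  from assms obtain c d where
    "\<And>y. y \<in> Y \<Longrightarrow> \<phi> y = (\<Sum>\<alpha>\<in>exponent_box m. \<Sum>s\<in>S. c \<alpha> s * ((\<Prod>i\<in>UNIV. lam i y ^ \<alpha> i) * e s y))"
    "\<And>y. y \<in> Y \<Longrightarrow> \<psi> y = (\<Sum>\<alpha>\<in>exponent_box m. \<Sum>s\<in>S. d \<alpha> s * ((\<Prod>i\<in>UNIV. lam i y ^ \<alpha> i) * e s y))"
    by (auto simp: monomial_span_def)
  then show ?thesis
    by (auto simp: monomial_span_def distrib_right sum.distrib intro!: exI[of _ "\<lambda>\<alpha> s. c \<alpha> s + d \<alpha> s"])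
qed

lemma monomial_span_cmult:
  assumes "\<phi> \<in> monomial_span Y lam S e m"
  shows "(\<lambda>y. b * \<phi> y) \<in> monomial_span Y lam S e m"
proof -
  from assms obtain c where
    "\<And>y. y \<in> Y \<Longrightarrow> \<phi> y = (\<Sum>\<alpha>\<in>exponent_box m. \<Sum>s\<in>S. c \<alpha> s * ((\<Prod>i\<in>UNIV. lam i y ^ \<alpha> i) * e s y))"
    by (auto simp: monomial_span_def)
  then show ?thesis
    by (auto simp: monomial_span_def mult.assoc sum_distrib_left intro!: exI[of _ "\<lambda>\<alpha> s. b * c \<alpha> s"])
qed

lemma monomial_span_sum:
  assumes "\<And>k. k \<in> K \<Longrightarrow> \<phi> k \<in> monomial_span Y lam S e m"
  shows "(\<lambda>y. \<Sum>k\<in>K. \<phi> k y) \<in> monomial_span Y lam S e m"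
  using assms
  by (induction K rule: infinite_finite_induct) (auto intro: monomial_span_zero monomial_span_add)

lemma monomial_span_generator:
  assumes "\<alpha> \<in> exponent_box m" "s \<in> S"
  shows "(\<lambda>y. (\<Prod>i\<in>UNIV. lam i y ^ \<alpha> i) * e s y) \<in> monomial_span Y lam S e m"
proof -
  have "(\<Sum>\<beta>\<in>exponent_box m. \<Sum>u\<in>S. (if \<beta> = \<alpha> \<and> u = s then 1 else 0) * ((\<Prod>i\<in>UNIV. lam i y ^ \<beta> i) * e u y))
     = (\<Prod>i\<in>UNIV. lam i y ^ \<alpha> i) * e s y" for y
  proof -
    have "(\<Sum>\<beta>\<in>exponent_box m. \<Sum>u\<in>S. (if \<beta> = \<alpha> \<and> u = s then 1 else 0) * ((\<Prod>i\<in>UNIV. lam i y ^ \<beta> i) * e u y))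
      = (\<Sum>\<beta>\<in>exponent_box m. if \<beta> = \<alpha> then (\<Prod>i\<in>UNIV. lam i y ^ \<alpha> i) * e s y else 0)"
    proof (rule sum.cong[OF refl])
      fix \<beta> :: "'n \<Rightarrow> nat"
      have "(\<Sum>u\<in>S. (if \<beta> = \<alpha> \<and> u = s then 1 else 0) * ((\<Prod>i\<in>UNIV. lam i y ^ \<beta> i) * e u y))
        = (\<Sum>u\<in>S. if u = s then (if \<beta> = \<alpha> then (\<Prod>i\<in>UNIV. lam i y ^ \<alpha> i) * e s y else 0) else 0)"
        by (rule sum.cong) auto
      also have "\<dots> = (if \<beta> = \<alpha> then (\<Prod>i\<in>UNIV. lam i y ^ \<alpha> i) * e s y else 0)"
        using S assms(2) by simp
      finally show "(\<Sum>u\<in>S. (if \<beta> = \<alpha> \<and> u = s then 1 else 0) * ((\<Prod>i\<in>UNIV. lam i y ^ \<beta> i) * e u y))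
        = (if \<beta> = \<alpha> then (\<Prod>i\<in>UNIV. lam i y ^ \<alpha> i) * e s y else 0)" .
    qed
    also have "\<dots> = (\<Prod>i\<in>UNIV. lam i y ^ \<alpha> i) * e s y"
      using assms(1) by (subst sum.delta[OF finite_exponent_box]) simp
    finally show ?thesis .
  qed
  then show ?thesis
    unfolding monomial_span_def
    by (intro CollectI exI[of _ "\<lambda>\<beta> u. if \<beta> = \<alpha> \<and> u = s then 1 else 0"]) simp
qed

lemma monomial_span_base:
  "(\<lambda>y. \<Sum>s\<in>S. c s * e s y) \<in> monomial_span Y lam S e 0"
proof (rule monomial_span_sum, rule monomial_span_cmult)
  fix s assume "s \<in> S"
  then show "e s \<in> monomial_span Y lam S e 0"
    using monomial_span_generator[of "\<lambda>_. 0" 0 s] by (simp add: exponent_box_def)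
qed

lemma monomial_span_mult:
  assumes "\<phi> \<in> monomial_span Y lam S e m"
  shows "(\<lambda>y. lam k y * \<phi> y) \<in> monomial_span Y lam S e (Suc m)"
proof -
  from assms obtain c where
    c: "\<And>y. y \<in> Y \<Longrightarrow> \<phi> y = (\<Sum>\<alpha>\<in>exponent_box m. \<Sum>s\<in>S. c \<alpha> s * ((\<Prod>i\<in>UNIV. lam i y ^ \<alpha> i) * e s y))"
    by (auto simp: monomial_span_def)
  have shift: "lam k y * (\<Prod>i\<in>UNIV. lam i y ^ \<alpha> i) = (\<Prod>i\<in>UNIV. lam i y ^ (\<alpha>(k := Suc (\<alpha> k))) i)" for \<alpha> y
  proof -
    have "(\<Prod>i\<in>UNIV. lam i y ^ (\<alpha>(k := Suc (\<alpha> k))) i) = (\<Prod>i\<in>UNIV. (if i = k then lam k y else 1) * lam i y ^ \<alpha> i)"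
      by (rule prod.cong) auto
    then show ?thesis by (simp add: prod.distrib)
  qed
  have "(\<lambda>y. \<Sum>\<alpha>\<in>exponent_box m. \<Sum>s\<in>S. c \<alpha> s *
      ((\<Prod>i\<in>UNIV. lam i y ^ (\<alpha>(k := Suc (\<alpha> k))) i) * e s y)) \<in> monomial_span Y lam S e (Suc m)"
  proof (intro monomial_span_sum monomial_span_cmult monomial_span_generator)
    fix \<alpha> :: "'n \<Rightarrow> nat" assume "\<alpha> \<in> exponent_box m"
    then show "\<alpha>(k := Suc (\<alpha> k)) \<in> exponent_box (Suc m)" by (auto simp: exponent_box_def le_SucI)
  qed
  then show ?thesis
  proof (rule monomial_span_cong)
    fix y assume "y \<in> Y"
    from c[OF this] show "lam k y * \<phi> y = (\<Sum>\<alpha>\<in>exponent_box m. \<Sum>s\<in>S. c \<alpha> s *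
        ((\<Prod>i\<in>UNIV. lam i y ^ (\<alpha>(k := Suc (\<alpha> k))) i) * e s y))"
      unfolding shift[symmetric] by (simp add: sum_distrib_left mult_ac)
  qed
qed

lemma monomial_span_mono:
  assumes "\<phi> \<in> monomial_span Y lam S e m" "m \<le> m'"
  shows "\<phi> \<in> monomial_span Y lam S e m'"
proof -
  from assms(1) obtain c where
    c: "\<And>y. y \<in> Y \<Longrightarrow> \<phi> y = (\<Sum>\<alpha>\<in>exponent_box m. \<Sum>s\<in>S. c \<alpha> s * ((\<Prod>i\<in>UNIV. lam i y ^ \<alpha> i) * e s y))"
    by (auto simp: monomial_span_def)
  have "(\<lambda>y. \<Sum>\<alpha>\<in>exponent_box m. \<Sum>s\<in>S. c \<alpha> s * ((\<Prod>i\<in>UNIV. lam i y ^ \<alpha> i) * e s y)) \<in> monomial_span Y lam S e m'"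
  proof (intro monomial_span_sum monomial_span_cmult monomial_span_generator)
    fix \<alpha> :: "'n \<Rightarrow> nat" assume "\<alpha> \<in> exponent_box m"
    then show "\<alpha> \<in> exponent_box m'"
      unfolding exponent_box_def using assms(2) by (auto intro: order_trans)
  qed
  then show ?thesis by (rule monomial_span_cong) (rule c)
qed

lemma monomial_span_mult_power:
  assumes "\<phi> \<in> monomial_span Y lam S e m"
  shows "(\<lambda>y. lam k y ^ d * \<phi> y) \<in> monomial_span Y lam S e (m + d)"
proof (induction d)
  case (Suc d)
  from monomial_span_mult[OF this, of k] show ?case by (simp add: mult.assoc)
qed (use assms in simp)

lemma monomial_span_mult_monomial:
  assumes "\<phi> \<in> monomial_span Y lam S e m"
  shows "(\<lambda>y. (\<Prod>j\<in>J. lam j y ^ \<delta> j) * \<phi> y) \<in> monomial_span Y lam S e (m + (\<Sum>j\<in>J. \<delta> j))"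
proof -
  have "finite J" by simp
  then show ?thesis
  proof (induction J rule: finite_induct)
    case (insert k J)
    from monomial_span_mult_power[OF insert.IH, of k "\<delta> k"] insert.hyps show ?case
      by (simp add: mult.assoc add_ac)
  qed (use assms in simp)
qed

text \<open>Otherwise the linear system for the coefficients of a relation has fewer equations than unknowns.\<close>

lemma card_independent_in_monomial_span:
  assumes K: "finite K" and span: "\<And>k. k \<in> K \<Longrightarrow> \<phi> k \<in> monomial_span Y lam S e m"
    and ind: "\<And>c. (\<And>y. y \<in> Y \<Longrightarrow> (\<Sum>k\<in>K. c k * \<phi> k y) = 0) \<Longrightarrow> (\<And>k. k \<in> K \<Longrightarrow> c k = 0)"
  shows "card K \<le> (m + 1) ^ CARD('n) * card S"
proof (rule ccontr)
  assume neg: "\<not> ?thesis"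
  have "\<forall>k. \<exists>c. k \<in> K \<longrightarrow> (\<forall>y\<in>Y. \<phi> k y =
      (\<Sum>\<alpha>\<in>exponent_box m. \<Sum>s\<in>S. c \<alpha> s * ((\<Prod>i\<in>UNIV. lam i y ^ \<alpha> i) * e s y)))"
    using span by (auto simp: monomial_span_def)
  from choice[OF this] obtain M where M: "\<And>k y. k \<in> K \<Longrightarrow> y \<in> Y \<Longrightarrow> \<phi> k y =
      (\<Sum>\<alpha>\<in>exponent_box m. \<Sum>s\<in>S. M k \<alpha> s * ((\<Prod>i\<in>UNIV. lam i y ^ \<alpha> i) * e s y))" by auto
  let ?T = "(exponent_box m :: ('n \<Rightarrow> nat) set) \<times> S"
  have "finite ?T" using S finite_exponent_box by blast
  moreover have "card ?T < card K" using neg by (simp add: card_cartesian_product card_exponent_box)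
  ultimately obtain c where c: "\<exists>k\<in>K. c k \<noteq> 0"
      "\<forall>p\<in>?T. (\<Sum>k\<in>K. c k * (case p of (\<alpha>, s) \<Rightarrow> M k \<alpha> s)) = 0"
    using linear_system_nontrivial[OF _ K, of ?T "\<lambda>k p. case p of (\<alpha>, s) \<Rightarrow> M k \<alpha> s"] by blast
  have "(\<Sum>k\<in>K. c k * \<phi> k y) = 0" if y: "y \<in> Y" for y
  proof -
    let ?g = "\<lambda>\<alpha> s. (\<Prod>i\<in>UNIV. lam i y ^ \<alpha> i) * e s y"
    have "(\<Sum>k\<in>K. c k * \<phi> k y) = (\<Sum>k\<in>K. \<Sum>p\<in>?T. c k * M k (fst p) (snd p) * ?g (fst p) (snd p))"
      using y by (intro sum.cong[OF refl])
        (simp add: M sum_distrib_left sum.cartesian_product case_prod_unfold mult.assoc)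
    also have "\<dots> = (\<Sum>p\<in>?T. (\<Sum>k\<in>K. c k * M k (fst p) (snd p)) * ?g (fst p) (snd p))"
      by (subst sum.swap) (simp add: sum_distrib_right)
    also have "\<dots> = 0"
      using c(2) by (intro sum.neutral) (auto simp: case_prod_unfold)
    finally show ?thesis .
  qed
  with ind c(1) show False by blast
qed

end

lemma forms_in_monomial_span:
  assumes "f \<in> forms t"
  shows "f \<in> monomial_span Z (\<lambda>i x. x $ i) {()} (\<lambda>_ _. 1) t"
  using assms
proof (induction t arbitrary: f)
  case 0
  then obtain c where "f = (\<lambda>x. c)" by (rule forms_0E)
  then show ?case using monomial_span_base[of "{()}" "\<lambda>_. c" "\<lambda>_ _. 1" Z "\<lambda>i x. x $ i"] by simp
next
  case (Suc t)
  from Suc.prems obtain g where g: "\<And>i. g i \<in> forms t" "f = (\<lambda>x. \<Sum>i\<in>UNIV. x $ i * g i x)"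
    by (rule forms_SucE) blast
  show ?case unfolding g(2)
    by (rule monomial_span_sum, simp) (rule monomial_span_mult[OF _ Suc.IH[OF g(1)]], simp)
qed

text \<open>
  This settles rank zero, where there is no quadratic form to argue with: all forms of degree \<open>t\<close> lie in
  the span of \<open>(t + 1)\<^sup>n\<close> monomials, which limits the growth of independent families.
\<close>

lemma chain_length_le_dimension:
  fixes Z :: "nat \<Rightarrow> (complex ^ 'n::finite) set"
  assumes "\<And>i. i \<le> D \<Longrightarrow> prime_cone (Z i)" "\<And>i. i < D \<Longrightarrow> Z i \<subseteq> Z (Suc i)"
    and "\<And>i. i < D \<Longrightarrow> \<exists>a. \<exists>f\<in>forms a. (\<forall>x\<in>Z i. f x = 0) \<and> (\<exists>x\<in>Z (Suc i). f x \<noteq> 0)"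
  shows "D \<le> CARD('n)"
proof (rule ccontr)
  assume "\<not> ?thesis"
  then have D: "D > CARD('n)" by simp
  obtain c where c: "c > 0" "\<And>t. \<exists>m. independent_forms (Z D) t m \<and> c * real t ^ D \<le> real m"
    using independent_forms_growth[of D Z] assms by blast
  have "c * real t ^ D \<le> 2 ^ CARD('n) * real t ^ CARD('n)" if "t \<ge> 1" for t
  proof -
    obtain m where m: "c * real t ^ D \<le> real m" "independent_forms (Z D) t m"
      using c(2)[of t] by blast
    from m(2) obtain b where b: "independent_family (Z D) t m b" by (auto simp: independent_forms_def)
    have "card {..<m} \<le> (t + 1) ^ CARD('n) * card {()}"
      by (rule card_independent_in_monomial_span[of _ _ b "Z D" "\<lambda>i x. x $ i" "\<lambda>_ _. 1"])
        (use independent_familyD[OF b] forms_in_monomial_span[OF independent_family_forms[OF b]] in auto)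
    then have "m \<le> (t + 1) ^ CARD('n)" by simp
    also have "\<dots> \<le> (2 * t) ^ CARD('n)" using that by (intro power_mono) auto
    finally have "real m \<le> (2 * real t) ^ CARD('n)"
      by (metis of_nat_le_iff of_nat_power of_nat_mult of_nat_numeral)
    with m(1) show ?thesis by (simp add: power_mult_distrib)
  qed
  from power_growth_contradiction[OF c(1) D this] show False by blast
qed


section \<open>Symmetric matrices of forms with constant rank\<close>

lemma det_in_forms:
  fixes M :: "complex ^ 'n::finite \<Rightarrow> complex ^ 'm::finite ^ 'm"
  assumes "\<And>i j. (\<lambda>x. M x $ i $ j) \<in> forms (d i)"
  shows "(\<lambda>x. det (M x)) \<in> forms (\<Sum>i\<in>UNIV. d i)"
  unfolding det_def
proof (rule forms_lincomb)
  fix p :: "'m \<Rightarrow> 'm"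
  show "(\<lambda>x. \<Prod>i\<in>UNIV. M x $ i $ p i) \<in> forms (\<Sum>i\<in>UNIV. d i)"
    by (rule forms_prod) (rule assms)
qed

lemma cofactor_in_forms:
  fixes M :: "complex ^ 'n::finite \<Rightarrow> complex ^ 'm::finite ^ 'm"
  assumes "\<And>i j. (\<lambda>x. M x $ i $ j) \<in> forms e"
  shows "(\<lambda>x. cofactor (M x) m k) \<in> forms ((CARD('m) - 1) * e)"
proof -
  have "(\<lambda>x. cofactor (M x) m k) \<in> forms (\<Sum>j\<in>UNIV. if j = k then 0 else e)"
    unfolding cofactor_def
  proof (rule det_in_forms)
    fix j i
    show "(\<lambda>x. (\<chi> j. if j = k then axis m 1 else column j (M x)) $ j $ i) \<in> forms (if j = k then 0 else e)"
      using assms by (simp add: column_def)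
  qed
  moreover have "(\<Sum>j\<in>UNIV. if j = k then 0 else e) = (CARD('m) - 1) * e"
  proof -
    have "(\<Sum>j\<in>UNIV. if j = k then 0 else e) = (\<Sum>j\<in>UNIV - {k}. e)"
      by (rule sum.mono_neutral_cong_right) auto
    then show ?thesis by (simp add: card_Diff_singleton)
  qed
  ultimately show ?thesis by simp
qed

text \<open>Induction on the number of variables: collect the powers of the last one.\<close>

lemma monomials_independent:
  fixes \<gamma> :: "('i \<Rightarrow> nat) \<Rightarrow> complex"
  assumes "finite J"
    and "\<And>z. (\<Sum>\<delta>\<in>PiE J (\<lambda>_. {..<a}). \<gamma> \<delta> * (\<Prod>j\<in>J. z j ^ \<delta> j)) = 0"
    and "\<delta> \<in> PiE J (\<lambda>_. {..<a})"
  shows "\<gamma> \<delta> = 0"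
  using assms
proof (induction J arbitrary: \<gamma> \<delta> rule: finite_induct)
  case empty
  then show ?case by simp
next
  case (insert k J)
  let ?P = "PiE J (\<lambda>_. {..<a})"
  have split: "(\<Sum>\<delta>\<in>PiE (insert k J) (\<lambda>_. {..<a}). \<gamma> \<delta> * (\<Prod>j\<in>insert k J. z j ^ \<delta> j))
     = (\<Sum>d<a. (\<Sum>\<delta>\<in>?P. \<gamma> (\<delta>(k := d)) * (\<Prod>j\<in>J. z j ^ \<delta> j)) * z k ^ d)" for z
  proof -
    have inj: "inj_on (\<lambda>(y, g). g(k := y)) ({..<a} \<times> ?P)"
      using inj_combinator[OF insert.hyps(2), of "\<lambda>_. {..<a}"] by simp
    have prod: "(\<Prod>j\<in>J. z j ^ (\<delta>(k := d)) j) = (\<Prod>j\<in>J. z j ^ \<delta> j)" for \<delta> d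
      by (rule prod.cong) (use insert.hyps in auto)
    have "(\<Sum>\<delta>\<in>PiE (insert k J) (\<lambda>_. {..<a}). \<gamma> \<delta> * (\<Prod>j\<in>insert k J. z j ^ \<delta> j))
       = (\<Sum>(d, \<delta>)\<in>{..<a} \<times> ?P. \<gamma> (\<delta>(k := d)) * (\<Prod>j\<in>insert k J. z j ^ (\<delta>(k := d)) j))"
      unfolding PiE_insert_eq by (subst sum.reindex[OF inj]) (simp add: case_prod_unfold)
    also have "\<dots> = (\<Sum>d<a. \<Sum>\<delta>\<in>?P. \<gamma> (\<delta>(k := d)) * (z k ^ d * (\<Prod>j\<in>J. z j ^ \<delta> j)))"
      unfolding sum.cartesian_product prod.insert[OF insert.hyps] prod by simp
    finally show ?thesis by (simp add: sum_distrib_right sum_distrib_left mult_ac)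
  qed
  from insert.prems(2) obtain d \<delta>' where d: "d < a" "\<delta>' \<in> ?P" "\<delta> = \<delta>'(k := d)"
    unfolding PiE_insert_eq by auto
  then obtain a' where a': "a = Suc a'" by (cases a) auto
  have "(\<Sum>\<delta>\<in>?P. \<gamma> (\<delta>(k := d)) * (\<Prod>j\<in>J. z j ^ \<delta> j)) = 0" for z
  proof -
    let ?c = "\<lambda>d. \<Sum>\<delta>\<in>?P. \<gamma> (\<delta>(k := d)) * (\<Prod>j\<in>J. z j ^ \<delta> j)"
    have "(\<Sum>d\<le>a'. ?c d * s ^ d) = 0" for s
    proof -
      have prod: "(\<Prod>j\<in>J. (z(k := s)) j ^ \<delta> j) = (\<Prod>j\<in>J. z j ^ \<delta> j)" for \<delta> :: "'i \<Rightarrow> nat"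
        by (rule prod.cong) (use insert.hyps in auto)
      have "{..a'} = {..<a}" using a' by (simp add: lessThan_Suc_atMost)
      moreover have "(\<Sum>d<a. ?c d * s ^ d) = 0"
        using insert.prems(1)[of "z(k := s)"] unfolding split prod by simp
      ultimately show ?thesis by simp
    qed
    then have "\<forall>d\<le>a'. ?c d = 0" by (subst polyfun_eq_0[symmetric]) blast
    with d(1) a' show ?thesis by simp
  qed
  from insert.IH[OF this d(2)] d(3) show ?case by simp
qed

text \<open>
  The Zariski closure of the cone. The Nullstellensatz produces common zeros of ideals that contain all
  forms vanishing on \<open>Z\<close>, in high degrees at least; such zeros are only known to be in this closure.
\<close>

definition vanishing_closure :: "(complex ^ 'n::finite) set \<Rightarrow> (complex ^ 'n) set" where
  "vanishing_closure Z = {c. \<forall>t. \<forall>f\<in>forms t. (\<forall>x\<in>Z. f x = 0) \<longrightarrow> f c = 0}"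

lemma vanishing_closureD:
  "c \<in> vanishing_closure Z \<Longrightarrow> f \<in> forms t \<Longrightarrow> (\<And>x. x \<in> Z \<Longrightarrow> f x = 0) \<Longrightarrow> f c = 0"
  by (simp add: vanishing_closure_def)

context
  fixes A :: "complex ^ 'n::finite \<Rightarrow> complex ^ 'n ^ 'n" and Z :: "(complex ^ 'n) set" and e r :: nat
  assumes A_sym: "\<And>x. transpose (A x) = A x"
    and A_forms: "\<And>i j. (\<lambda>x. A x $ i $ j) \<in> forms e"
    and e: "e \<ge> 1"
    and Z: "prime_cone Z"
    and rank: "\<forall>c\<in>vanishing_closure Z - {0}. rank (A c) = r"
begin

abbreviation (input) lam :: "'n \<Rightarrow> complex ^ 'n \<Rightarrow> complex ^ 'n \<Rightarrow> complex" where
  "lam i x w \<equiv> (A x *v w) $ i"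

definition quad :: "complex ^ 'n \<Rightarrow> complex ^ 'n \<Rightarrow> complex" where
  "quad x w = (\<Sum>k\<in>UNIV. w $ k * lam k x w)"

lemma lam_in_forms: "(\<lambda>x. lam i x w) \<in> forms e"
proof -
  have "(\<lambda>x. \<Sum>j\<in>UNIV. w $ j * A x $ i $ j) \<in> forms e"
    by (rule forms_lincomb) (rule A_forms)
  then show ?thesis by (simp add: matrix_vector_mult_def mult.commute)
qed

lemma quad_in_forms: "(\<lambda>x. quad x w) \<in> forms e"
  unfolding quad_def by (rule forms_lincomb) (rule lam_in_forms)

lemma rank_on: "x \<in> Z \<Longrightarrow> x \<noteq> 0 \<Longrightarrow> rank (A x) = r"
  using rank by (auto simp: vanishing_closure_def)

text \<open>
  The perturbation \<open>C\<close> that makes \<open>A c\<close> invertible is multiplied by \<open>l\<^sup>e\<close>, where \<open>l\<close> is a linear form with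
  \<open>l(c) = 1\<close>, so that the entries of \<open>M\<close> are forms of the same degree as those of \<open>A\<close>.
\<close>

lemma pencil:
  assumes c: "c \<noteq> 0" "rank (A c) = r"
  obtains J M where "card J = r" "\<And>i j. (\<lambda>x. M x $ i $ j) \<in> forms e"
    "\<And>x i. i \<in> J \<Longrightarrow> M x $ i = A x $ i" "det (M c) \<noteq> 0" "det (M 0) = 0"
proof -
  obtain J C where JC: "card J = rank (A c)" "\<And>i. i \<in> J \<Longrightarrow> C $ i = 0" "det (A c + C) \<noteq> 0"
    by (rule rank_completion[of "A c"]) blast
  from c(1) obtain i where i: "c $ i \<noteq> 0" by (auto simp: vec_eq_iff)
  define l where "l = (\<lambda>x :: complex ^ 'n. 1 / c $ i * x $ i)"
  have "l \<in> forms 1" unfolding l_def by (rule forms_cmult) (rule forms_coord)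
  then have le: "(\<lambda>x. l x ^ e) \<in> forms e" using forms_power[of l 1 e] by simp
  define M where "M x = (\<chi> i j. A x $ i $ j + C $ i $ j * l x ^ e)" for x
  have Mf: "(\<lambda>x. M x $ i $ j) \<in> forms e" for i j
    unfolding M_def using forms_add[OF A_forms forms_cmult[OF le]] by simp
  have "M x $ i = A x $ i" if "i \<in> J" for x i
    using JC(2)[OF that] by (simp add: M_def vec_eq_iff)
  moreover have "M c = A c + C" using i by (simp add: M_def l_def vec_eq_iff)
  moreover have "det (M 0) = 0"
  proof -
    have "M 0 $ i $ j = 0" for i j
      using forms_scale[OF Mf, of 0 0 i j] e by (simp add: zero_power)
    then have "M 0 = mat 0" by (simp add: vec_eq_iff mat_def)
    then show ?thesis by (simp only: det_0)
  qed
  ultimately show ?thesis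
    using that[of J M] JC Mf c(2) by simp
qed

text \<open>
  By \<open>quadratic_form_via_cofactors\<close> the relation holds where \<open>M\<close> is invertible. For fixed \<open>w\<close> both sides
  are forms in \<open>x\<close>, so it holds on all of \<open>Z\<close>, because \<open>Z\<close> is irreducible.
\<close>

lemma pencil_relation:
  assumes J: "card J = r" and M: "\<And>i j. (\<lambda>x. M x $ i $ j) \<in> forms e"
    "\<And>x i. i \<in> J \<Longrightarrow> M x $ i = A x $ i" "det (M 0) = 0"
    and z: "z \<in> Z" "det (M z) \<noteq> 0" and x: "x \<in> Z"
  shows "quad x w * det (M x) =
     (\<Sum>k\<in>UNIV. \<Sum>m\<in>UNIV. lam k x w * (lam m x w * cofactor (M x) m k))"
proof -
  let ?D = "\<lambda>x. quad x w * det (M x) -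
     (\<Sum>k\<in>UNIV. \<Sum>m\<in>UNIV. lam k x w * (lam m x w * cofactor (M x) m k))"
  have det: "(\<lambda>x. det (M x)) \<in> forms (CARD('n) * e)"
    using det_in_forms[of M "\<lambda>_. e"] M(1) by simp
  have n: "e + CARD('n) * e = e + (e + (CARD('n) - 1) * e)"
    by (cases "CARD('n)") auto
  have "(\<lambda>x. quad x w * det (M x)) \<in> forms (e + CARD('n) * e)"
    by (rule forms_mult[OF quad_in_forms det])
  moreover have "(\<lambda>x. \<Sum>k\<in>UNIV. \<Sum>m\<in>UNIV. lam k x w * (lam m x w * cofactor (M x) m k))
      \<in> forms (e + CARD('n) * e)"
    unfolding n by (intro forms_sum forms_mult[OF lam_in_forms] cofactor_in_forms M(1))
  ultimately have "?D \<in> forms (e + CARD('n) * e)"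
    using forms_add[OF _ forms_cmult[of _ _ "-1"]] by (metis (no_types, lifting) ext mult_minus1 uminus_add_conv_diff add.commute)
  then have "?D x = 0"
  proof (rule prime_coneD[OF Z det _ _ z x])
    fix y assume y: "y \<in> Z"
    show "det (M y) * ?D y = 0"
    proof (cases "det (M y) = 0")
      case False
      then have "y \<noteq> 0" using M(3) by auto
      then have "rank (A y) = r" using y rank_on by blast
      then have "(\<Sum>k\<in>UNIV. w $ k * (A y *v w) $ k) * det (A y + (M y - A y)) =
         (\<Sum>k\<in>UNIV. \<Sum>m\<in>UNIV. (A y *v w) $ k * (A y *v w) $ m * cofactor (A y + (M y - A y)) m k)"
        using False J M(2) by (intro quadratic_form_via_cofactors[where J = J] A_sym) simp_all
      then show ?thesis by (simp add: quad_def mult.assoc)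
    qed simp
  qed
  then show ?thesis by simp
qed

text \<open>
  The forms \<open>h\<close> for which \<open>q h\<close> is a quadratic form in \<open>\<lambda> = A x w\<close>, with coefficients forms in \<open>x\<close> of
  degree lower by \<open>e\<close>. The zero form is admitted separately for the sake of degrees below \<open>e\<close>.
\<close>

definition quad_ideal :: "(nat \<times> (complex ^ 'n \<Rightarrow> complex)) set" where
  "quad_ideal = {(t, h). h \<in> forms t \<and> (h = (\<lambda>x. 0) \<or> (\<exists>u g. t = u + e \<and> (\<forall>k m. g k m \<in> forms u) \<and>
     (\<forall>x\<in>Z. \<forall>w. quad x w * h x = (\<Sum>k\<in>UNIV. \<Sum>m\<in>UNIV. lam k x w * (lam m x w * g k m x)))))}"

lemma quad_idealI:
  assumes "h \<in> forms (u + e)" "\<And>k m. g k m \<in> forms u"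
    "\<And>x w. x \<in> Z \<Longrightarrow> quad x w * h x = (\<Sum>k\<in>UNIV. \<Sum>m\<in>UNIV. lam k x w * (lam m x w * g k m x))"
  shows "(u + e, h) \<in> quad_ideal"
  using assms unfolding quad_ideal_def by blast

lemma quad_idealE:
  assumes "(t, h) \<in> quad_ideal"
  obtains "h = (\<lambda>x. 0)" | u g where "t = u + e" "\<forall>k m. g k m \<in> forms u"
    "\<forall>x\<in>Z. \<forall>w. quad x w * h x = (\<Sum>k\<in>UNIV. \<Sum>m\<in>UNIV. lam k x w * (lam m x w * g k m x))"
  using assms unfolding quad_ideal_def by blast

lemma quad_ideal_forms: "(t, h) \<in> quad_ideal \<Longrightarrow> h \<in> forms t"
  by (simp add: quad_ideal_def)

lemma graded_quad_ideal: "graded_ideal quad_ideal"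
  unfolding graded_ideal_def
proof (intro conjI allI impI)
  fix t show "(t, \<lambda>x. 0) \<in> quad_ideal" by (simp add: quad_ideal_def)
next
  fix t f f' assume f: "(t, f) \<in> quad_ideal" and f': "(t, f') \<in> quad_ideal"
  from f show "(t, \<lambda>x. f x + f' x) \<in> quad_ideal"
  proof (cases rule: quad_idealE)
    case 1
    then show ?thesis using f' by simp
  next
    case (2 u g)
    note fg = 2
    from f' show ?thesis
    proof (cases rule: quad_idealE)
      case 1
      then show ?thesis using f by simp
    next
      case (2 u' g')
      with fg have u: "u' = u" by simp
      show ?thesis
        unfolding fg(1)
      proof (rule quad_idealI)
        show "(\<lambda>x. f x + f' x) \<in> forms (u + e)"
          using quad_ideal_forms[OF f] quad_ideal_forms[OF f'] fg(1) by (simp add: forms_add)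
        show "(\<lambda>x. g k m x + g' k m x) \<in> forms u" for k m
          using fg(2) 2(2) u by (simp add: forms_add)
        show "quad x w * (f x + f' x) = (\<Sum>k\<in>UNIV. \<Sum>m\<in>UNIV. lam k x w * (lam m x w * (g k m x + g' k m x)))"
          if "x \<in> Z" for x w
          using fg(3) 2(3) that by (simp add: distrib_left sum.distrib)
      qed
    qed
  qed
next
  fix t f v and k :: "complex ^ 'n \<Rightarrow> complex" assume f: "(t, f) \<in> quad_ideal" and k: "k \<in> forms v"
  from f show "(t + v, \<lambda>x. f x * k x) \<in> quad_ideal"
  proof (cases rule: quad_idealE)
    case 1
    then show ?thesis by (simp add: quad_ideal_def)
  next
    case (2 u g)
    have eq: "t + v = (u + v) + e" using 2(1) by simp
    show ?thesis
      unfolding eq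
    proof (rule quad_idealI)
      show "(\<lambda>x. f x * k x) \<in> forms (u + v + e)"
        using forms_mult[OF quad_ideal_forms[OF f] k] eq by simp
      show "(\<lambda>x. g i m x * k x) \<in> forms (u + v)" for i m
        using 2(2) k by (simp add: forms_mult)
      show "quad x w * (f x * k x) = (\<Sum>i\<in>UNIV. \<Sum>m\<in>UNIV. lam i x w * (lam m x w * (g i m x * k x)))"
        if "x \<in> Z" for x w
      proof -
        have "quad x w * (f x * k x) = (quad x w * f x) * k x" by simp
        also have "\<dots> = (\<Sum>i\<in>UNIV. \<Sum>m\<in>UNIV. lam i x w * (lam m x w * g i m x)) * k x"
          using 2(3) that by simp
        finally show ?thesis by (simp add: sum_distrib_right mult.assoc)
      qed
    qed
  qed
qed (rule quad_ideal_forms)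

text \<open>
  At a point of the closure of \<open>Z\<close> the determinant of a pencil serves. At any other point some form
  vanishing on \<open>Z\<close> does not vanish; multiplied by a power of a coordinate, which makes room for
  the drop of \<open>e\<close> in the degree of the coefficients, it is in the ideal with coefficients zero.
\<close>

lemma quad_ideal_no_zero:
  assumes c: "c \<noteq> 0" shows "\<exists>t h. (t, h) \<in> quad_ideal \<and> h c \<noteq> 0"
proof (cases "c \<in> vanishing_closure Z")
  case True
  then have rc: "rank (A c) = r" using c rank by blast
  obtain J M where JM: "card J = r" "\<And>i j. (\<lambda>x. M x $ i $ j) \<in> forms e"
    "\<And>x i. i \<in> J \<Longrightarrow> M x $ i = A x $ i" "det (M c) \<noteq> 0" "det (M 0) = 0"
    using pencil[OF c rc] by blast
  have det: "(\<lambda>x. det (M x)) \<in> forms (CARD('n) * e)"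
    using det_in_forms[of M "\<lambda>_. e"] JM(2) by simp
  from vanishing_closureD[OF True this] JM(4) obtain z where z: "z \<in> Z" "det (M z) \<noteq> 0" by blast
  have n: "CARD('n) * e = (CARD('n) - 1) * e + e" by (cases "CARD('n)") auto
  have "((CARD('n) - 1) * e + e, \<lambda>x. det (M x)) \<in> quad_ideal"
  proof (rule quad_idealI)
    show "(\<lambda>x. det (M x)) \<in> forms ((CARD('n) - 1) * e + e)" using det n by simp
    show "(\<lambda>x. cofactor (M x) m k) \<in> forms ((CARD('n) - 1) * e)" for k m
      by (rule cofactor_in_forms) (rule JM(2))
  qed (rule pencil_relation[OF JM(1,2,3,5) z])
  with JM(4) show ?thesis by blast
next
  case False
  then obtain t f where f: "f \<in> forms t" "\<And>x. x \<in> Z \<Longrightarrow> f x = 0" "f c \<noteq> 0"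
    by (auto simp: vanishing_closure_def)
  from c obtain i where i: "c $ i \<noteq> 0" by (auto simp: vec_eq_iff)
  have xi: "(\<lambda>x. (x $ i) ^ e) \<in> forms e" using forms_power[OF forms_coord[of i], of e] by simp
  have "(t + e, \<lambda>x. f x * (x $ i) ^ e) \<in> quad_ideal"
    by (rule quad_idealI[of _ _ "\<lambda>_ _ x. 0"]) (use forms_mult[OF f(1) xi] f(2) in auto)
  with i f(3) show ?thesis
    by (intro exI[of _ "t + e"] exI[of _ "\<lambda>x. f x * (x $ i) ^ e"]) simp
qed

text \<open>
  Each factor \<open>quad\<close> trades \<open>e\<close> degrees in \<open>x\<close> for two factors \<open>lam\<close>, as long as the degree in \<open>x\<close>
  is at least the bound \<open>t\<close> provided by the Nullstellensatz.
\<close>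

lemma quad_power_in_span:
  assumes t: "contains_degree quad_ideal t"
    and g: "g \<in> forms (t + a * e)"
  shows "(\<lambda>(x, w). quad x w ^ a * g x) \<in> monomial_span (Z \<times> UNIV) (\<lambda>i (x, w). lam i x w)
     {ws. length ws = t} (\<lambda>ws (x, w). \<Prod>i\<leftarrow>ws. x $ i) (2 * a)"
    (is "_ \<in> monomial_span ?Y ?lam ?S ?e _")
  using g
proof (induction a arbitrary: g)
  case 0
  then have "g \<in> forms t" by simp
  from forms_word_expansion[OF this]
  obtain c where c: "g = (\<lambda>x. \<Sum>ws\<in>?S. c ws * (\<Prod>i\<leftarrow>ws. x $ i))" by (elim exE)
  show ?case unfolding mult_0_right
    by (rule monomial_span_cong[OF finite_words monomial_span_base[OF finite_words, of c]])
      (auto simp: c)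
next
  case (Suc a)
  have "contains_degree quad_ideal (t + Suc a * e)"
    using contains_degree_mono[OF graded_quad_ideal t] by simp
  with Suc.prems have "(t + Suc a * e, g) \<in> quad_ideal" by (simp add: contains_degree_def)
  then show ?case
  proof (cases rule: quad_idealE)
    case 1
    then show ?thesis
      by (intro monomial_span_cong[OF finite_words monomial_span_zero[OF finite_words]]) auto
  next
    case (2 u h)
    have u: "u = t + a * e" using 2(1) by simp
    have "(\<lambda>y. \<Sum>k\<in>UNIV. \<Sum>m\<in>UNIV. ?lam k y * (?lam m y * (\<lambda>(x, w). quad x w ^ a * h k m x) y))
        \<in> monomial_span ?Y ?lam ?S ?e (Suc (Suc (2 * a)))"
      by (intro monomial_span_sum[OF finite_words] monomial_span_mult[OF finite_words] Suc.IH)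
        (use 2(2) u in simp)
    then show ?thesis unfolding mult_Suc_right add_2_eq_Suc
    proof (rule monomial_span_cong[OF finite_words])
      fix y assume "y \<in> ?Y"
      then obtain x w where y: "y = (x, w)" "x \<in> Z" by auto
      have "quad x w ^ Suc a * g x = quad x w ^ a * (quad x w * g x)" by simp
      also have "\<dots> = quad x w ^ a * (\<Sum>k\<in>UNIV. \<Sum>m\<in>UNIV. lam k x w * (lam m x w * h k m x))"
        using 2(3) y by simp
      also have "\<dots> = (\<Sum>k\<in>UNIV. \<Sum>m\<in>UNIV. lam k x w * (lam m x w * (quad x w ^ a * h k m x)))"
        by (simp add: sum_distrib_left mult_ac)
      finally show "(case y of (x, w) \<Rightarrow> quad x w ^ Suc a * g x) =
         (\<Sum>k\<in>UNIV. \<Sum>m\<in>UNIV. ?lam k y * (?lam m y * (\<lambda>(x, w). quad x w ^ a * h k m x) y))"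
        by (simp add: y)
    qed
  qed
qed

text \<open>
  The set of \<open>w\<close> with \<open>quad x w \<noteq> 0\<close> is dense: on a line in a direction \<open>w0\<close> with \<open>quad x w0 \<noteq> 0\<close>, the
  form is a polynomial of degree two with finitely many roots.
\<close>

lemma quad_times_continuous_zero:
  assumes x: "A x \<noteq> 0" and G: "continuous_on UNIV G"
    and prod: "\<And>w. quad x w ^ a * G w = 0"
  shows "G w = 0"
proof -
  obtain w0 where w0: "quad x w0 \<noteq> 0"
    using symmetric_form_nonzero[OF A_sym x] by (auto simp: quad_def)
  define q1 where "q1 = (\<Sum>k\<in>UNIV. w $ k * lam k x w0) + (\<Sum>k\<in>UNIV. w0 $ k * lam k x w)"
  have q: "quad x (w + s *s w0) = poly [:quad x w, q1, quad x w0:] s" for s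
    by (simp add: quad_def q1_def matrix_vector_right_distrib vector_scalar_commute algebra_simps
        sum.distrib sum_distrib_left)
  have "finite {s. poly [:quad x w, q1, quad x w0:] s = 0}"
    by (rule poly_roots_finite) (use w0 in auto)
  then have "\<forall>\<^sub>F s in at 0. s \<notin> {s. poly [:quad x w, q1, quad x w0:] s = 0}"
    using islimpt_finite islimpt_iff_eventually by blast
  then have "\<forall>\<^sub>F s in at 0. G (w + s *s w0) = 0"
  proof eventually_elim
    case (elim s)
    then have "quad x (w + s *s w0) \<noteq> 0" unfolding q by blast
    with prod[of "w + s *s w0"] show ?case by simp
  qed
  then have "((\<lambda>s. G (w + s *s w0)) \<longlongrightarrow> 0) (at 0)" by (rule tendsto_eventually)
  moreover have "((\<lambda>s. G (w + s *s w0)) \<longlongrightarrow> G (w + 0 *s w0)) (at 0)"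
  proof -
    have cont: "continuous_on UNIV (\<lambda>s. w + s *s w0)"
    proof -
      have "(\<lambda>s. w + s *s w0) = (\<lambda>s. \<chi> i. w $ i + s * w0 $ i)" by (simp add: fun_eq_iff vec_eq_iff)
      moreover have "continuous_on UNIV (\<lambda>s. \<chi> i. w $ i + s * w0 $ i)"
        by (intro continuous_intros)
      ultimately show ?thesis by (simp only:)
    qed
    have "continuous_on UNIV (\<lambda>s. G (w + s *s w0))"
      by (rule continuous_on_compose2[OF G cont]) auto
    then have "\<forall>x. ((\<lambda>s. G (w + s *s w0)) \<longlongrightarrow> G (w + x *s w0)) (at x)"
      by (simp add: continuous_on_def)
    then show ?thesis by (rule spec)
  qed
  ultimately have "G (w + 0 *s w0) = 0"
    using tendsto_unique[of "at (0 :: complex)"] by (metis at_neq_bot)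
  then show ?thesis by simp
qed

text \<open>
  The functions counted on the left are \<open>q\<^sup>a b\<^sub>i(x) \<lambda>\<^sub>J\<^sup>\<delta>\<close> with \<open>b\<^sub>i\<close> independent on \<open>Z\<close>, exponents \<open>\<delta>\<^sub>j < a\<close>, and \<open>J\<close> a
  set of \<open>r\<close> rows of \<open>A x\<close> that are independent for \<open>x\<close> outside the zeros of \<open>det M\<close>. In a linear relation
  the factor \<open>q\<^sup>a\<close> can be cancelled. For fixed \<open>x\<close> with \<open>det (M x) \<noteq> 0\<close> the coordinates \<open>\<lambda>\<^sub>J\<close> take all values, so the
  coefficient of each monomial in them vanishes, and this is a relation between the \<open>b\<^sub>i\<close>.
\<close>

lemma card_bound:
  assumes r: "r \<ge> 1" and t: "contains_degree quad_ideal t"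
    and ind: "independent_forms Z (t + a * e) m"
  shows "m * a ^ r \<le> (2 * a + r * a + 1) ^ CARD('n) * card {ws :: 'n list. length ws = t}"
proof -
  from ind obtain b where b: "independent_family Z (t + a * e) m b" by (auto simp: independent_forms_def)
  from Z obtain x0 where x0: "x0 \<in> Z" "x0 \<noteq> 0" by (auto simp: prime_cone_def)
  obtain J M where JM: "card J = r" "\<And>i j. (\<lambda>x. M x $ i $ j) \<in> forms e"
    "\<And>x i. i \<in> J \<Longrightarrow> M x $ i = A x $ i" "det (M x0) \<noteq> 0" "det (M 0) = 0"
    using pencil[OF x0(2) rank_on[OF x0]] by blast
  define P where "P = PiE J (\<lambda>_. {..<a})"
  define K where "K = {..<m} \<times> P"
  define \<phi> where "\<phi> k = (\<lambda>(x, w). (\<Prod>j\<in>J. lam j x w ^ snd k j) * (quad x w ^ a * b (fst k) x))" for k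
  have finP: "finite P" unfolding P_def by (rule finite_PiE) auto
  have "card K \<le> (2 * a + r * a + 1) ^ CARD('n) * card {ws :: 'n list. length ws = t}"
  proof (rule card_independent_in_monomial_span[OF finite_words, where \<phi> = \<phi> and Y = "Z \<times> UNIV"
        and lam = "\<lambda>i (x, w). lam i x w" and e = "\<lambda>ws (x, w). \<Prod>i\<leftarrow>ws. x $ i"])
    show "finite K" using finP by (simp add: K_def)
  next
    fix k assume k: "k \<in> K"
    then have bk: "b (fst k) \<in> forms (t + a * e)"
      using independent_family_forms[OF b] by (auto simp: K_def)
    have "(\<Sum>j\<in>J. snd k j) \<le> card J * a"
      using sum_bounded_above[of J "snd k" a] k by (force simp: K_def P_def PiE_def Pi_def)
    then have le: "2 * a + (\<Sum>j\<in>J. snd k j) \<le> 2 * a + r * a" using JM(1) by simp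
    show "\<phi> k \<in> monomial_span (Z \<times> UNIV) (\<lambda>i (x, w). lam i x w) {ws. length ws = t}
        (\<lambda>ws (x, w). \<Prod>i\<leftarrow>ws. x $ i) (2 * a + r * a)"
      by (rule monomial_span_cong[OF finite_words monomial_span_mono[OF finite_words
              monomial_span_mult_monomial[OF finite_words quad_power_in_span[OF t bk]] le]])
        (auto simp: \<phi>_def)
  next
    fix c k
    assume c: "\<And>y. y \<in> Z \<times> UNIV \<Longrightarrow> (\<Sum>k\<in>K. c k * \<phi> k y) = 0" and k: "k \<in> K"
    define F where "F \<delta> = (\<lambda>x. \<Sum>i<m. c (i, \<delta>) * b i x)" for \<delta>
    have F: "F \<delta> \<in> forms (t + a * e)" for \<delta>
      unfolding F_def by (rule forms_lincomb) (use independent_family_forms[OF b] in auto)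
    have zero: "F \<delta> x = 0" if x: "x \<in> Z" "det (M x) \<noteq> 0" and \<delta>: "\<delta> \<in> P" for x \<delta>
    proof -
      have "x \<noteq> 0" using x(2) JM(5) by auto
      then have "rank (A x) = r" using rank_on x(1) by blast
      moreover have "rank (0 :: complex ^ 'n ^ 'n) = 0"
      proof -
        have "rows (0 :: complex ^ 'n ^ 'n) \<subseteq> {0}" by (auto simp: rows_def row_def vec_eq_iff)
        then have "vec.span (rows (0 :: complex ^ 'n ^ 'n)) \<subseteq> {0}"
          using vec.span_mono[of _ "{0 :: complex ^ 'n}"] by simp
        then show ?thesis unfolding row_rank_def_gen
          using vec.dim_eq_0[of "rows (0 :: complex ^ 'n ^ 'n)"] vec.span_superset by blast
      qed
      ultimately have A: "A x \<noteq> 0" using r by auto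
      define G where "G w = (\<Sum>\<delta>\<in>P. F \<delta> x * (\<Prod>j\<in>J. lam j x w ^ \<delta> j))" for w
      have "quad x w ^ a * G w = 0" for w
      proof -
        have "quad x w ^ a * G w = (\<Sum>\<delta>\<in>P. \<Sum>i<m. c (i, \<delta>) * \<phi> (i, \<delta>) (x, w))"
          by (simp add: G_def F_def \<phi>_def sum_distrib_left sum_distrib_right mult_ac)
        also have "\<dots> = (\<Sum>k\<in>K. c k * \<phi> k (x, w))"
          unfolding K_def by (subst sum.swap) (simp add: sum.cartesian_product case_prod_unfold)
        finally show ?thesis using c[of "(x, w)"] x(1) by simp
      qed
      moreover have "continuous_on UNIV G"
        unfolding G_def matrix_vector_mult_def by (auto intro!: continuous_intros)
      ultimately have G: "G w = 0" for w
        using quad_times_continuous_zero[OF A] by blast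
      have "surj ((*v) (M x))"
        using x(2) invertible_det_nz[of "M x"] by (simp add: invertible_eq_bij bij_is_surj)
      have "(\<Sum>\<delta>\<in>P. F \<delta> x * (\<Prod>j\<in>J. z j ^ \<delta> j)) = 0" for z
      proof -
        obtain w where w: "M x *v w = (\<chi> i. z i)" using \<open>surj ((*v) (M x))\<close> by (metis surjE)
        have "lam j x w = z j" if "j \<in> J" for j
        proof -
          have "lam j x w = (M x *v w) $ j" using JM(3)[OF that] by (simp add: matrix_vector_mult_def)
          then show ?thesis by (simp add: w)
        qed
        then have "G w = (\<Sum>\<delta>\<in>P. F \<delta> x * (\<Prod>j\<in>J. z j ^ \<delta> j))"
          unfolding G_def by (intro sum.cong prod.cong refl arg_cong2[where f = "(*)"]) auto
        with G show ?thesis by simp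
      qed
      then show ?thesis
        using monomials_independent[where J = J and a = a and \<gamma> = "\<lambda>\<delta>. F \<delta> x" and \<delta> = \<delta>] \<delta> unfolding P_def by simp
    qed
    have det: "(\<lambda>x. det (M x)) \<in> forms (CARD('n) * e)"
      using det_in_forms[of M "\<lambda>_. e"] JM(2) by simp
    have "F (snd k) x = 0" if "x \<in> Z" for x
    proof (rule prime_coneD[OF Z det F _ x0(1) JM(4) that])
      fix y assume "y \<in> Z"
      moreover have "snd k \<in> P" using k by (auto simp: K_def)
      ultimately have "det (M y) \<noteq> 0 \<Longrightarrow> F (snd k) y = 0" using zero by blast
      then show "det (M y) * F (snd k) y = 0" by (cases "det (M y) = 0") simp_all
    qed
    then have "c (fst k, snd k) = 0"
      using independent_familyD[OF b, of "\<lambda>i. c (i, snd k)" "fst k"] k by (auto simp: F_def K_def)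
    then show "c k = 0" by simp
  qed
  moreover have "card K = m * a ^ r"
    using JM(1) by (simp add: K_def P_def card_cartesian_product card_PiE)
  ultimately show ?thesis by simp
qed

end

text \<open>
  With about \<open>a\<^sup>D\<close> independent forms of degree \<open>t + a e\<close> in \<open>card_bound\<close>, the left hand side grows like
  \<open>a\<^sup>D\<^sup>+\<^sup>r\<close>, and the right hand side like \<open>a\<^sup>n\<close>.
\<close>

theorem constant_rank_bound:
  fixes A :: "complex ^ 'n::finite \<Rightarrow> complex ^ 'n ^ 'n" and Z :: "nat \<Rightarrow> (complex ^ 'n) set"
  assumes A: "\<And>x. transpose (A x) = A x" "\<And>i j. (\<lambda>x. A x $ i $ j) \<in> forms e" "e \<ge> 1"
    and Z: "\<And>i. i \<le> D \<Longrightarrow> prime_cone (Z i)" "\<And>i. i < D \<Longrightarrow> Z i \<subseteq> Z (Suc i)"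
      "\<And>i. i < D \<Longrightarrow> \<exists>a. \<exists>f\<in>forms a. (\<forall>x\<in>Z i. f x = 0) \<and> (\<exists>x\<in>Z (Suc i). f x \<noteq> 0)"
    and rank: "\<forall>c\<in>vanishing_closure (Z D) - {0}. rank (A c) = r"
  shows "D + r \<le> CARD('n)"
proof (cases "r = 0")
  case True
  then show ?thesis using chain_length_le_dimension[of D Z] Z by simp
next
  case False
  then have r: "r \<ge> 1" by simp
  have ZD: "prime_cone (Z D)" using Z(1) by simp
  note ctx = A ZD rank
  obtain t where t: "contains_degree (quad_ideal A (Z D) e) t"
    using projective_nullstellensatz[OF graded_quad_ideal[OF ctx] quad_ideal_no_zero[OF ctx]] by blast
  obtain c where c: "c > 0" "\<And>t. \<exists>m. independent_forms (Z D) t m \<and> c * real t ^ D \<le> real m"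
    using independent_forms_growth[of D Z] Z by blast
  define N where "N = card {ws :: 'n list. length ws = t}"
  show ?thesis
  proof (rule ccontr)
    assume "\<not> ?thesis"
    then have D: "D + r > CARD('n)" by simp
    have "c * real a ^ (D + r) \<le> (real N * real (3 + r) ^ CARD('n)) * real a ^ CARD('n)" if a: "a \<ge> 1" for a
    proof -
      obtain m where m: "independent_forms (Z D) (t + a * e) m" "c * real (t + a * e) ^ D \<le> real m"
        using c(2) by blast
      have "a \<le> t + a * e" using A(3) by (simp add: trans_le_add2)
      then have "real a \<le> real (t + a * e)" by (simp only: of_nat_le_iff)
      from power_mono[OF this] have "c * real a ^ D \<le> c * real (t + a * e) ^ D"
        using c(1) by simp
      with m(2) have "c * real a ^ D \<le> real m" by simp
      then have "c * real a ^ (D + r) \<le> real m * real a ^ r"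
        by (simp add: power_add mult.assoc[symmetric] mult_right_mono)
      also have "\<dots> = real (m * a ^ r)" by simp
      also have "\<dots> \<le> real ((2 * a + r * a + 1) ^ CARD('n) * N)"
        using card_bound[OF ctx r t m(1)] unfolding N_def by (simp only: of_nat_le_iff)
      also have "\<dots> \<le> real (((3 + r) * a) ^ CARD('n) * N)"
        using a by (intro of_nat_mono mult_right_mono power_mono) (auto simp: algebra_simps)
      also have "\<dots> = (real N * real (3 + r) ^ CARD('n)) * real a ^ CARD('n)"
        by (simp add: power_mult_distrib)
      finally show ?thesis .
    qed
    from power_growth_contradiction[OF c(1) D this] show False by blast
  qed
qed


section \<open>Cones over closed sets of the Zariski topology\<close>

definition nonvanishing :: "(complex ^ 'n::finite \<Rightarrow> complex) \<Rightarrow> (complex ^ 'n) set set" where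
  "nonvanishing f = {p \<in> proj_space. \<exists>v\<in>p. f v \<noteq> 0}"

lemma form_zero_on_line:
  assumes "f \<in> forms k" "p \<in> proj_space" "u \<in> p" "u \<noteq> 0" "f u = 0" "v \<in> p"
  shows "f v = 0"
proof -
  obtain w where w: "w \<noteq> 0" "p = vec.span {w}" using assms(2) by (auto simp: proj_space_def)
  obtain a b where ab: "u = a *s w" "v = b *s w"
    using assms(3,6) w(2) by (auto simp: vec.span_singleton)
  with assms(4) have "a \<noteq> 0" by auto
  with ab have "v = (b / a) *s u" by simp
  then show ?thesis using forms_scale[OF assms(1), of "b / a" u] assms(5) by simp
qed

lemma proj_space_nonzero: "p \<in> proj_space \<Longrightarrow> \<exists>u\<in>p. u \<noteq> 0"
  by (auto simp: proj_space_def intro: vec.span_base)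

lemma nonvanishing_iff:
  assumes "f \<in> forms k" "p \<in> proj_space" "u \<in> p" "u \<noteq> 0"
  shows "p \<in> nonvanishing f \<longleftrightarrow> f u \<noteq> 0"
  using assms form_zero_on_line[OF assms] by (auto simp: nonvanishing_def)

lemma openin_nonvanishing:
  assumes "f \<in> forms k" shows "openin zariski (nonvanishing f)"
proof -
  obtain G where "homogeneous k G" "f = eval_poly G" using forms_obtain_poly[OF assms] .
  then show ?thesis
    unfolding zariski_def nonvanishing_def by (intro topology_generated_by_Basis) blast
qed

text \<open>
  Finite intersections of the generating sets are again of this form: multiply the forms.
\<close>

lemma nonvanishing_basis:
  fixes U :: "(complex ^ 'n::finite) set set"
  assumes "openin zariski U" "p \<in> U"
  shows "\<exists>k. \<exists>f\<in>forms k. p \<in> nonvanishing f \<and> nonvanishing f \<subseteq> U"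
proof -
  have "generate_topology_on {{p \<in> proj_space. \<exists>v\<in>p. eval_poly G v \<noteq> 0} | G k. homogeneous k G} U"
    using assms(1) unfolding zariski_def openin_topology_generated_by_iff .
  then show ?thesis
    using assms(2)
  proof (induction U arbitrary: p rule: generate_topology_on.induct)
    case (Int a b)
    then obtain k f l g where fg: "f \<in> forms k" "p \<in> nonvanishing f" "nonvanishing f \<subseteq> a"
      "g \<in> forms l" "p \<in> nonvanishing g" "nonvanishing g \<subseteq> b" by (meson IntD1 IntD2)
    have p: "p \<in> proj_space" using fg(2) by (simp add: nonvanishing_def)
    obtain u where u: "u \<in> p" "u \<noteq> 0" using proj_space_nonzero[OF p] by blast
    have "f u * g u \<noteq> 0"
      using nonvanishing_iff[OF fg(1) p u] nonvanishing_iff[OF fg(4) p u] fg(2,5) by simp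
    with p u have "p \<in> nonvanishing (\<lambda>x. f x * g x)" by (auto simp: nonvanishing_def)
    moreover have "nonvanishing (\<lambda>x. f x * g x) \<subseteq> a \<inter> b"
      using fg(3,6) by (auto simp: nonvanishing_def)
    ultimately show ?case using forms_mult[OF fg(1,4)] by blast
  next
    case (Basis s)
    then obtain G k where G: "homogeneous k G" "s = nonvanishing (eval_poly G)"
      by (auto simp: nonvanishing_def)
    with Basis.prems eval_poly_in_forms[OF G(1)] show ?case by blast
  qed (simp, blast)
qed

lemma closedin_proj_top_subset:
  assumes "closedin (proj_top I) Z" shows "Z \<subseteq> proj_points I"
  using closedin_subset[OF assms] by (auto simp: proj_top_def)

text \<open>The complement of a closed set is covered by basic open sets.\<close>

lemma separating_form:
  assumes "closedin (proj_top I) Z" "p \<in> topspace (proj_top I)" "p \<notin> Z"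
  shows "\<exists>k. \<exists>f\<in>forms k. (\<forall>x\<in>\<Union>Z. f x = 0) \<and> (\<exists>v\<in>p. f v \<noteq> 0)"
proof -
  have "openin (proj_top I) (topspace (proj_top I) - Z)" using assms(1) by (rule openin_diff[OF openin_topspace])
  then obtain U where U: "openin zariski U" "topspace (proj_top I) - Z = U \<inter> proj_points I"
    by (auto simp: proj_top_def openin_subtopology)
  with assms(2,3) obtain k f where f: "f \<in> forms k" "p \<in> nonvanishing f" "nonvanishing f \<subseteq> U"
    using nonvanishing_basis[of U p] by blast
  have "f x = 0" if "x \<in> q" "q \<in> Z" for x q
  proof (rule ccontr)
    assume fx: "f x \<noteq> 0"
    have q: "q \<in> proj_points I" using closedin_proj_top_subset[OF assms(1)] that(2) by blast
    then have "q \<in> nonvanishing f" using fx that(1) by (auto simp: nonvanishing_def proj_points_def)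
    with f(3) q U(2) that(2) show False by blast
  qed
  then show ?thesis using f(1,2) by (auto simp: nonvanishing_def)
qed

lemma prime_cone_irreducible_closed:
  assumes "irreducible_closed (proj_top I) Z" shows "prime_cone (\<Union>Z)"
  unfolding prime_cone_def
proof (intro conjI allI ballI impI)
  have closed: "closedin (proj_top I) Z" and ne: "Z \<noteq> {}"
    and irr: "\<And>A B. closedin (proj_top I) A \<Longrightarrow> closedin (proj_top I) B \<Longrightarrow> Z = A \<union> B \<Longrightarrow> Z = A \<or> Z = B"
    using assms by (auto simp: irreducible_closed_def)
  have ps: "p \<in> proj_space" "p \<in> proj_points I" if "p \<in> Z" for p
    using closedin_proj_top_subset[OF closed] that by (auto simp: proj_points_def)
  from ne obtain p where "p \<in> Z" by blast
  with proj_space_nonzero[OF ps(1)] show "\<exists>v\<in>\<Union>Z. v \<noteq> 0" by blast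
  fix a b :: nat and f g :: "complex ^ 'a \<Rightarrow> complex"
  assume f: "f \<in> forms a" and g: "g \<in> forms b" and fg: "\<forall>x\<in>\<Union>Z. f x * g x = 0"
  have cl: "closedin (proj_top I) (Z - nonvanishing h)" if "h \<in> forms k" for h k
  proof -
    have "openin (proj_top I) (nonvanishing h \<inter> proj_points I)"
      unfolding proj_top_def using openin_nonvanishing[OF that] by (rule openin_subtopology_Int)
    from closedin_diff[OF closed this] have "closedin (proj_top I) (Z - nonvanishing h \<inter> proj_points I)" .
    moreover have "Z - nonvanishing h \<inter> proj_points I = Z - nonvanishing h" using ps(2) by blast
    ultimately show ?thesis by simp
  qed
  have "Z = (Z - nonvanishing f) \<union> (Z - nonvanishing g)"
  proof (intro equalityI subsetI)
    fix q assume q: "q \<in> Z"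
    obtain u where u: "u \<in> q" "u \<noteq> 0" using proj_space_nonzero[OF ps(1)[OF q]] by blast
    have "f u * g u = 0" using fg u q by blast
    with q nonvanishing_iff[OF f ps(1)[OF q] u] nonvanishing_iff[OF g ps(1)[OF q] u]
    show "q \<in> (Z - nonvanishing f) \<union> (Z - nonvanishing g)" by auto
  qed auto
  from irr[OF cl[OF f] cl[OF g] this]
  show "(\<forall>x\<in>\<Union>Z. f x = 0) \<or> (\<forall>x\<in>\<Union>Z. g x = 0)"
    using ps(1) by (auto simp: nonvanishing_def)
qed

text \<open>
  A polynomial in the ideal is the sum of its homogeneous components. These are in the ideal as well, so
  they are forms vanishing on the cone over \<open>Z\<close>, and hence they vanish at \<open>c\<close>.
\<close>

lemma vanishing_closure_subset_proj_points:
  fixes I :: "'n::finite cpoly set"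
  assumes I: "homogeneous_ideal I" and Z: "Z \<subseteq> proj_points I"
    and c: "c \<in> vanishing_closure (\<Union>Z)" "c \<noteq> 0"
  shows "vec.span {c} \<in> proj_points I"
proof -
  have "eval_poly f v = 0" if f: "f \<in> I" and v: "v \<in> vec.span {c}" for f v
  proof -
    obtain b where b: "v = b *s c" using v by (auto simp: vec.span_singleton)
    have "\<forall>k. \<exists>g. g \<in> I \<and> (\<forall>m. Poly_Mapping.lookup g m = (if mon_degree m = k then Poly_Mapping.lookup f m else 0))"
      using I f unfolding homogeneous_ideal_def by blast
    from choice[OF this] obtain g where g: "\<And>k. g k \<in> I"
      "\<And>k m. Poly_Mapping.lookup (g k) m = (if mon_degree m = k then Poly_Mapping.lookup f m else 0)" by blast
    have hom: "homogeneous k (g k)" for k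
      unfolding homogeneous_def by (auto simp: in_keys_iff g(2) split: if_splits)
    have "eval_poly (g k) c = 0" for k
    proof (rule vanishing_closureD[OF c(1) eval_poly_in_forms[OF hom]])
      fix x assume "x \<in> \<Union>Z"
      with Z g(1) show "eval_poly (g k) x = 0" by (auto simp: proj_points_def)
    qed
    then have zero: "eval_poly (g k) v = 0" for k
      unfolding b eval_poly_scale[OF hom] by simp
    let ?K = "mon_degree ` Poly_Mapping.keys f"
    have "f = (\<Sum>k\<in>?K. g k)"
    proof (rule poly_mapping_eqI)
      fix m
      show "Poly_Mapping.lookup f m = Poly_Mapping.lookup (\<Sum>k\<in>?K. g k) m"
        by (cases "m \<in> Poly_Mapping.keys f") (auto simp: lookup_sum g(2) in_keys_iff)
    qed
    then have "eval_poly f v = (\<Sum>k\<in>?K. eval_poly (g k) v)" by (metis eval_poly_sum)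
    with zero show ?thesis by simp
  qed
  moreover have "vec.span {c} \<in> proj_space" using c(2) by (auto simp: proj_space_def)
  ultimately show ?thesis by (simp add: proj_points_def)
qed


section \<open>The Hessian\<close>

definition hessian :: "'n::finite cpoly \<Rightarrow> complex ^ 'n \<Rightarrow> complex ^ 'n ^ 'n" where
  "hessian F x = (\<chi> i j. dir_deriv (axis i 1) (dir_deriv (axis j 1) (eval_poly F)) x)"

lemma hessian_symmetric:
  assumes "homogeneous d F" shows "transpose (hessian F x) = hessian F x"
  using dir_deriv_commute[OF eval_poly_in_forms[OF assms]]
  by (simp add: hessian_def transpose_def vec_eq_iff)

lemma hessian_in_forms:
  assumes F: "homogeneous d F" and d: "d \<ge> 3"
  shows "(\<lambda>x. hessian F x $ i $ j) \<in> forms (d - 2)"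
proof -
  have "d = Suc (Suc (d - 2))" using d by simp
  then have "eval_poly F \<in> forms (Suc (Suc (d - 2)))" using eval_poly_in_forms[OF F] by simp
  from dir_deriv_in_forms[OF dir_deriv_in_forms[OF this]] show ?thesis by (simp add: hessian_def)
qed

lemma form_rank_hessian:
  assumes "homogeneous d F" "d \<ge> 3" "c \<noteq> 0"
  shows "form_rank F (vec.span {c}) = rank (hessian F c)"
proof -
  have c: "c \<in> vec.span {c}" by (simp add: vec.span_base)
  have "vec.span {c} \<in> proj_space" using assms(3) by (auto simp: proj_space_def)
  moreover have "hessian_matrix F (vec.span {c}) c = hessian F c"
    using c by (simp add: hessian_matrix_def hessian_form_def hessian_def)
  ultimately show ?thesis using form_rank_eq[OF assms(1,2) _ c assms(3)] by simp
qed

theorem proposition5p3: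
  fixes F :: "'n::finite cpoly" and I :: "'n cpoly set" and N d r :: nat
  assumes "CARD('n) = N + 1"
    and "d \<ge> 3"
    and "homogeneous d F"
    and "homogeneous_ideal I"
    and "\<exists>p\<in>proj_points I. form_rank F p = r"
    and "\<forall>p\<in>proj_points I. form_rank F p \<le> r"
    and "krull_dim (proj_top I) > ereal (real N + 1 - real r)"
  shows "rank_locus F I (int r - 1) \<noteq> {}"
proof
  assume empty: "rank_locus F I (int r - 1) = {}"
  have const: "form_rank F p = r" if "p \<in> proj_points I" for p
  proof -
    have "\<not> int (form_rank F p) \<le> int r - 1" using empty that by (auto simp: rank_locus_def)
    moreover have "form_rank F p \<le> r" using assms(6) that by blast
    ultimately show ?thesis by linarith
  qed
  from assms(7) obtain D Z where D: "ereal (real N + 1 - real r) < ereal (real D)"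
    and Z: "\<And>i. i \<le> D \<Longrightarrow> irreducible_closed (proj_top I) (Z i)" "\<And>i. i < D \<Longrightarrow> Z i \<subset> Z (Suc i)"
    unfolding krull_dim_def less_SUP_iff by blast
  have closed: "closedin (proj_top I) (Z i)" if "i \<le> D" for i
    using Z(1)[OF that] by (simp add: irreducible_closed_def)
  have "D + r \<le> CARD('n)"
  proof (rule constant_rank_bound[of "hessian F" "d - 2" D "\<lambda>i. \<Union>(Z i)" r])
    show "transpose (hessian F x) = hessian F x" for x
      by (rule hessian_symmetric[OF assms(3)])
    show "(\<lambda>x. hessian F x $ i $ j) \<in> forms (d - 2)" for i j
      by (rule hessian_in_forms[OF assms(3,2)])
    show "1 \<le> d - 2" using assms(2) by simp
    show "prime_cone (\<Union>(Z i))" if "i \<le> D" for i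
      using prime_cone_irreducible_closed[OF Z(1)[OF that]] .
    show "\<Union>(Z i) \<subseteq> \<Union>(Z (Suc i))" if "i < D" for i
      using Z(2)[OF that] by blast
    show "\<exists>a. \<exists>f\<in>forms a. (\<forall>x\<in>\<Union>(Z i). f x = 0) \<and> (\<exists>x\<in>\<Union>(Z (Suc i)). f x \<noteq> 0)" if i: "i < D" for i
    proof -
      obtain p where p: "p \<in> Z (Suc i)" "p \<notin> Z i" using Z(2)[OF i] by blast
      then have "p \<in> topspace (proj_top I)" using closedin_subset[OF closed[of "Suc i"]] i by auto
      with separating_form[OF closed _ p(2)] i obtain k f v where
        f: "f \<in> forms k" "\<forall>x\<in>\<Union>(Z i). f x = 0" "v \<in> p" "f v \<noteq> 0" by (meson less_imp_le)
      from f(3) p(1) have "v \<in> \<Union>(Z (Suc i))" by (rule UnionI[rotated])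
      with f show ?thesis by blast
    qed
    show "\<forall>c\<in>vanishing_closure (\<Union>(Z D)) - {0}. rank (hessian F c) = r"
    proof
      fix c assume "c \<in> vanishing_closure (\<Union>(Z D)) - {0}"
      then have c: "c \<in> vanishing_closure (\<Union>(Z D))" "c \<noteq> 0" by auto
      have "vec.span {c} \<in> proj_points I"
        by (rule vanishing_closure_subset_proj_points[OF assms(4) closedin_proj_top_subset[OF closed] c]) simp
      from const[OF this] form_rank_hessian[OF assms(3,2) c(2)] show "rank (hessian F c) = r" by simp
    qed
  qed
  with D assms(1) show False by simp
qed

end
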